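(* Let $\mathcal K$ be a category with chain bounds, and let $\downarrow^1$, $\downarrow^2$ be independence notions on $\mathcal K$ with existence and uniqueness such that: (1) $\downarrow^1$ is right monotonic; (2) $\downarrow^2$ is transitive and right accessible. Then $\downarrow^1=\downarrow^2$. In particular, $\mathcal K$ has at most one stable independence notion.
   Context: A category has *chain bounds* if every chain in it (diagram indexed by an ordinal) has a compatible cocone. Write $(A,B,C,D)$ for a commutative square with $A$ bottom left, $B$ top left, $C$ bottom right, $D$ top right (morphisms $A\to B$, $A\to C$, $B\to D$, $C\to D$). An independence relation (= independence notion) on $\mathcal K$ is a class $\downarrow$ of commutative squares in $\mathcal K$ (called independent) such that for every commutative square $(A,B,C,D)$ and every morphism $D\to E$, $(A,B,C,D)$ is independent iff the induced square $(A,B,C,E)$ is independent. It is: - *symmetric* if $(A,B,C,D)$ independent implies $(A,C,B,D)$ independent; - *right transitive* if whenever $(A,B,C,D)$ and $(C,D,E,F)$ are independent (sharing the morphism $C\to D$), the composite square $(A,B,E,F)$ is independent; *left transitive* if the dual relation $\downarrow^d$ (for which $(A,B,C,D)$ is independent iff $(A,C,B,D)$ is $\downarrow$-independent) is right transitive; *transitive* if both left and right transitive; - *right monotonic* if, given morphisms $A\to C\to C'$, whenever a square $(A,B,C',D)$ with bottom edge the composite $A\to C\to C'$ is independent, the square $(A,B,C,D)$ with edges $A\to C$ and $C\to C'\to D$ is independent; - it has *existence* if every span $B\leftarrow A\to C$ can be completed to an independent square $(A,B,C,D)$; - it has *uniqueness* if for any two independent squares $(A,B,C,D^1)$, $(A,B,C,D^2)$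 on the same span there are an object $D$ and morphisms $D^1\to D$, $D^2\to D$ whose composites from $B$ agree and whose composites from $C$ agree; - *right accessible* if the category $\mathcal K_{\downarrow}$, whose objects are the morphisms of $\mathcal K$ and whose morphisms from $(A\to B)$ to $(C\to D)$ are the independent squares $(A,B,C,D)$ (composed horizontally), is an accessible category; *accessible* if both $\downarrow$ and $\downarrow^d$ are right accessible. It is *stable* if it is symmetric, transitive, accessible, and has existence and uniqueness. *)

theory Defs
  imports Main "HOL-Library.FuncSet"
begin

unbundle cardinal_syntax

section \<open>Size\<close>

text \<open>
  The distinction between sets and proper classes is rendered by a (Grothendieck) universe: a
  strongly inaccessible cardinal \<open>\<kappa>\<close> on a type \<open>'u\<close> is fixed, and the sets are the collections of
  cardinality less than \<open>\<kappa>\<close>. Every such collection is equipotent to one consisting of elements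
  of \<open>'u\<close>, so that small ordinals, small index posets and small regular cardinals may all be taken
  as relations on \<open>'u\<close>. Objects and arrows of a category may be of any types, without any size
  restriction.
\<close>

definition inaccessible :: "'u rel \<Rightarrow> bool" where
  "inaccessible \<kappa> \<longleftrightarrow>
     Card_order \<kappa> \<and> natLeq <o \<kappa> \<and> regularCard \<kappa> \<and>
     (\<forall>A :: 'u set. |A| <o \<kappa> \<longrightarrow> |Pow A| <o \<kappa>)"

definition small :: "'u rel \<Rightarrow> 'a set \<Rightarrow> bool" where
  "small \<kappa> A \<longleftrightarrow> |A| <o \<kappa>"


section \<open>Categories\<close>

record ('o, 'm) cat =
  Obj :: "'o set"
  Arr :: "'m set"
  Dom :: "'m \<Rightarrow> 'o"
  Cod :: "'m \<Rightarrow> 'o"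
  Id :: "'o \<Rightarrow> 'm"
  Comp :: "'m \<Rightarrow> 'm \<Rightarrow> 'm"  (infixl "\<cdot>\<index>" 70)

definition hom :: "('o, 'm) cat \<Rightarrow> 'o \<Rightarrow> 'o \<Rightarrow> 'm set" where
  "hom K X Y = {f \<in> Arr K. Dom K f = X \<and> Cod K f = Y}"

locale category =
  fixes K :: "('o, 'm) cat" (structure)
  assumes Dom_in_Obj: "f \<in> Arr K \<Longrightarrow> Dom K f \<in> Obj K"
    and Cod_in_Obj: "f \<in> Arr K \<Longrightarrow> Cod K f \<in> Obj K"
    and Id_in_hom: "X \<in> Obj K \<Longrightarrow> Id K X \<in> hom K X X"
    and Comp_in_hom: "f \<in> hom K X Y \<Longrightarrow> g \<in> hom K Y Z \<Longrightarrow> g \<cdot> f \<in> hom K X Z"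
    and Comp_Id: "f \<in> hom K X Y \<Longrightarrow> f \<cdot> Id K X = f"
    and Id_Comp: "f \<in> hom K X Y \<Longrightarrow> Id K Y \<cdot> f = f"
    and Comp_assoc:
      "f \<in> hom K W X \<Longrightarrow> g \<in> hom K X Y \<Longrightarrow> h \<in> hom K Y Z \<Longrightarrow> (h \<cdot> g) \<cdot> f = h \<cdot> (g \<cdot> f)"

text \<open>A diagram indexed by the poset \<open>r\<close> (a reflexive order on \<open>Field r\<close>, viewed as a category):
  the object at \<open>i\<close> is \<open>D i\<close>, the arrow for \<open>i \<le> j\<close> is \<open>d i j\<close>.\<close>

definition diagram ::
  "('o, 'm) cat \<Rightarrow> 'i rel \<Rightarrow> ('i \<Rightarrow> 'o) \<Rightarrow> ('i \<Rightarrow> 'i \<Rightarrow> 'm) \<Rightarrow> bool" where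
  "diagram K r D d \<longleftrightarrow>
     (\<forall>i \<in> Field r. D i \<in> Obj K) \<and>
     (\<forall>i j. (i, j) \<in> r \<longrightarrow> d i j \<in> hom K (D i) (D j)) \<and>
     (\<forall>i \<in> Field r. d i i = Id K (D i)) \<and>
     (\<forall>i j k. (i, j) \<in> r \<longrightarrow> (j, k) \<in> r \<longrightarrow> d i k = d j k \<cdot>\<^bsub>K\<^esub> d i j)"

definition cocone ::
  "('o, 'm) cat \<Rightarrow> 'i rel \<Rightarrow> ('i \<Rightarrow> 'o) \<Rightarrow> ('i \<Rightarrow> 'i \<Rightarrow> 'm) \<Rightarrow> 'o \<Rightarrow> ('i \<Rightarrow> 'm) \<Rightarrow> bool" where
  "cocone K r D d Y c \<longleftrightarrow>
     Y \<in> Obj K \<and>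
     (\<forall>i \<in> Field r. c i \<in> hom K (D i) Y) \<and>
     (\<forall>i j. (i, j) \<in> r \<longrightarrow> c j \<cdot>\<^bsub>K\<^esub> d i j = c i)"

definition colimit ::
  "('o, 'm) cat \<Rightarrow> 'i rel \<Rightarrow> ('i \<Rightarrow> 'o) \<Rightarrow> ('i \<Rightarrow> 'i \<Rightarrow> 'm) \<Rightarrow> 'o \<Rightarrow> ('i \<Rightarrow> 'm) \<Rightarrow> bool" where
  "colimit K r D d L c \<longleftrightarrow>
     cocone K r D d L c \<and>
     (\<forall>Y b. cocone K r D d Y b \<longrightarrow>
        (\<exists>!h. h \<in> hom K L Y \<and> (\<forall>i \<in> Field r. h \<cdot>\<^bsub>K\<^esub> c i = b i)))"

text \<open>Ordinals are well-orders; the empty one is included.\<close>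

definition has_chain_bounds :: "'u rel \<Rightarrow> ('o, 'm) cat \<Rightarrow> bool" where
  "has_chain_bounds \<kappa> K \<longleftrightarrow>
     (\<forall>(r :: 'u rel) D d.
        Well_order r \<longrightarrow> small \<kappa> (Field r) \<longrightarrow> diagram K r D d \<longrightarrow> (\<exists>Y c. cocone K r D d Y c))"


section \<open>Accessible categories\<close>

definition directed_poset :: "'u rel \<Rightarrow> 'i rel \<Rightarrow> bool" where
  "directed_poset \<mu> r \<longleftrightarrow>
     Partial_order r \<and>
     (\<forall>X \<subseteq> Field r. |X| <o \<mu> \<longrightarrow> (\<exists>u \<in> Field r. \<forall>x \<in> X. (x, u) \<in> r))"

text \<open>
  An object \<open>X\<close> is \<open>\<mu>\<close>-presentable if the functor \<open>hom(X, -)\<close> into the category of sets preserves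
  colimits of small \<open>\<mu>\<close>-directed diagrams. The conclusion below is the universal property of
  \<open>hom(X, L)\<close> as a colimit of the sets \<open>hom(X, D i)\<close>: \<open>\<phi>\<close> is a cocone on these sets with vertex an
  arbitrary small set \<open>S\<close>, and \<open>\<psi>\<close> is the induced function.
\<close>

definition presentable :: "'u rel \<Rightarrow> 'u rel \<Rightarrow> ('o, 'm) cat \<Rightarrow> 'o \<Rightarrow> bool" where
  "presentable \<kappa> \<mu> K X \<longleftrightarrow>
     X \<in> Obj K \<and>
     (\<forall>(r :: 'u rel) D d L c.
        directed_poset \<mu> r \<longrightarrow> small \<kappa> (Field r) \<longrightarrow> diagram K r D d \<longrightarrow> colimit K r D d L c \<longrightarrow>
        (\<forall>(S :: 'u set) \<phi>.
           small \<kappa> S \<longrightarrow>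
           (\<forall>i \<in> Field r. \<phi> i \<in> hom K X (D i) \<rightarrow> S) \<longrightarrow>
           (\<forall>i j. (i, j) \<in> r \<longrightarrow> (\<forall>g \<in> hom K X (D i). \<phi> j (d i j \<cdot>\<^bsub>K\<^esub> g) = \<phi> i g)) \<longrightarrow>
           (\<exists>!\<psi>. \<psi> \<in> hom K X L \<rightarrow>\<^sub>E S \<and>
                 (\<forall>i \<in> Field r. \<forall>g \<in> hom K X (D i). \<psi> (c i \<cdot>\<^bsub>K\<^esub> g) = \<phi> i g))))"

definition accessible_at :: "'u rel \<Rightarrow> 'u rel \<Rightarrow> ('o, 'm) cat \<Rightarrow> bool" where
  "accessible_at \<kappa> \<mu> K \<longleftrightarrow>
     (\<forall>(r :: 'u rel) D d.
        directed_poset \<mu> r \<longrightarrow> small \<kappa> (Field r) \<longrightarrow> diagram K r D d \<longrightarrow>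
        (\<exists>L c. colimit K r D d L c)) \<and>
     (\<exists>P. small \<kappa> P \<and> (\<forall>X \<in> P. presentable \<kappa> \<mu> K X) \<and>
        (\<forall>Y \<in> Obj K. \<exists>(r :: 'u rel) D d c.
           directed_poset \<mu> r \<and> small \<kappa> (Field r) \<and> diagram K r D d \<and>
           (\<forall>i \<in> Field r. D i \<in> P) \<and> colimit K r D d Y c))"

text \<open>Accessible categories are locally small, as \<open>hom(X, -)\<close> is to take values in sets.\<close>

definition accessible :: "'u rel \<Rightarrow> ('o, 'm) cat \<Rightarrow> bool" where
  "accessible \<kappa> K \<longleftrightarrow>
     category K \<and>
     (\<forall>X \<in> Obj K. \<forall>Y \<in> Obj K. small \<kappa> (hom K X Y)) \<and>
     (\<exists>\<mu> :: 'u rel. Cinfinite \<mu> \<and> regularCard \<mu> \<and> \<mu> <o \<kappa> \<and> accessible_at \<kappa> \<mu> K)"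


section \<open>Independence notions\<close>

text \<open>
  The square \<open>(A, B, C, D)\<close> is the quadruple \<open>(ab, ac, bd, cd)\<close> of its arrows
  \<open>A \<rightarrow> B\<close> (left), \<open>A \<rightarrow> C\<close> (bottom), \<open>B \<rightarrow> D\<close> (top), \<open>C \<rightarrow> D\<close> (right).
\<close>

type_synonym 'm square = "'m \<times> 'm \<times> 'm \<times> 'm"

definition comm_squares :: "('o, 'm) cat \<Rightarrow> 'm square set" where
  "comm_squares K =
     {(ab, ac, bd, cd). \<exists>A B C D.
        ab \<in> hom K A B \<and> ac \<in> hom K A C \<and> bd \<in> hom K B D \<and> cd \<in> hom K C D \<and>
        bd \<cdot>\<^bsub>K\<^esub> ab = cd \<cdot>\<^bsub>K\<^esub> ac}"

definition independence_notion :: "('o, 'm) cat \<Rightarrow> 'm square set \<Rightarrow> bool" where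
  "independence_notion K I \<longleftrightarrow>
     I \<subseteq> comm_squares K \<and>
     (\<forall>ab ac bd cd. (ab, ac, bd, cd) \<in> comm_squares K \<longrightarrow>
        (\<forall>e \<in> Arr K. Dom K e = Cod K bd \<longrightarrow>
           ((ab, ac, bd, cd) \<in> I \<longleftrightarrow> (ab, ac, e \<cdot>\<^bsub>K\<^esub> bd, e \<cdot>\<^bsub>K\<^esub> cd) \<in> I)))"

definition dual :: "'m square set \<Rightarrow> 'm square set" where
  "dual I = {(ab, ac, bd, cd). (ac, ab, cd, bd) \<in> I}"

definition symmetric :: "'m square set \<Rightarrow> bool" where
  "symmetric I \<longleftrightarrow> (\<forall>ab ac bd cd. (ab, ac, bd, cd) \<in> I \<longrightarrow> (ac, ab, cd, bd) \<in> I)"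

definition right_transitive :: "('o, 'm) cat \<Rightarrow> 'm square set \<Rightarrow> bool" where
  "right_transitive K I \<longleftrightarrow>
     (\<forall>ab ac bd cd ce df ef. (ab, ac, bd, cd) \<in> I \<longrightarrow> (cd, ce, df, ef) \<in> I \<longrightarrow>
        (ab, ce \<cdot>\<^bsub>K\<^esub> ac, df \<cdot>\<^bsub>K\<^esub> bd, ef) \<in> I)"

definition left_transitive :: "('o, 'm) cat \<Rightarrow> 'm square set \<Rightarrow> bool" where
  "left_transitive K I \<longleftrightarrow> right_transitive K (dual I)"

definition transitive :: "('o, 'm) cat \<Rightarrow> 'm square set \<Rightarrow> bool" where
  "transitive K I \<longleftrightarrow> left_transitive K I \<and> right_transitive K I"

definition right_monotonic :: "('o, 'm) cat \<Rightarrow> 'm square set \<Rightarrow> bool" where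
  "right_monotonic K I \<longleftrightarrow>
     (\<forall>ab bd. \<forall>ac \<in> Arr K. \<forall>cc' \<in> Arr K. \<forall>c'd \<in> Arr K.
        Cod K ac = Dom K cc' \<longrightarrow> Cod K cc' = Dom K c'd \<longrightarrow>
        (ab, cc' \<cdot>\<^bsub>K\<^esub> ac, bd, c'd) \<in> I \<longrightarrow> (ab, ac, bd, c'd \<cdot>\<^bsub>K\<^esub> cc') \<in> I)"

definition has_existence :: "('o, 'm) cat \<Rightarrow> 'm square set \<Rightarrow> bool" where
  "has_existence K I \<longleftrightarrow>
     (\<forall>ab \<in> Arr K. \<forall>ac \<in> Arr K. Dom K ab = Dom K ac \<longrightarrow> (\<exists>bd cd. (ab, ac, bd, cd) \<in> I))"

definition has_uniqueness :: "('o, 'm) cat \<Rightarrow> 'm square set \<Rightarrow> bool" where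
  "has_uniqueness K I \<longleftrightarrow>
     (\<forall>ab ac bd1 cd1 bd2 cd2. (ab, ac, bd1, cd1) \<in> I \<longrightarrow> (ab, ac, bd2, cd2) \<in> I \<longrightarrow>
        (\<exists>D. \<exists>e1 \<in> hom K (Cod K bd1) D. \<exists>e2 \<in> hom K (Cod K bd2) D.
           e1 \<cdot>\<^bsub>K\<^esub> bd1 = e2 \<cdot>\<^bsub>K\<^esub> bd2 \<and> e1 \<cdot>\<^bsub>K\<^esub> cd1 = e2 \<cdot>\<^bsub>K\<^esub> cd2))"

text \<open>The category \<open>K\<^sub>\<down>\<close>: a square is an arrow from its left side to its right side, and
  squares are composed horizontally.\<close>

definition indep_cat :: "('o, 'm) cat \<Rightarrow> 'm square set \<Rightarrow> ('m, 'm square) cat" where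
  "indep_cat K I =
     \<lparr> Obj = Arr K,
       Arr = I,
       Dom = (\<lambda>(ab, ac, bd, cd). ab),
       Cod = (\<lambda>(ab, ac, bd, cd). cd),
       Id = (\<lambda>f. (f, Id K (Dom K f), Id K (Cod K f), f)),
       Comp = (\<lambda>(cd, ce, df, ef) (ab, ac, bd, cd'). (ab, ce \<cdot>\<^bsub>K\<^esub> ac, df \<cdot>\<^bsub>K\<^esub> bd, ef)) \<rparr>"

definition right_accessible :: "'u rel \<Rightarrow> ('o, 'm) cat \<Rightarrow> 'm square set \<Rightarrow> bool" where
  "right_accessible \<kappa> K I \<longleftrightarrow> accessible \<kappa> (indep_cat K I)"

definition accessible_notion :: "'u rel \<Rightarrow> ('o, 'm) cat \<Rightarrow> 'm square set \<Rightarrow> bool" where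
  "accessible_notion \<kappa> K I \<longleftrightarrow> right_accessible \<kappa> K I \<and> right_accessible \<kappa> K (dual I)"

definition stable_notion :: "'u rel \<Rightarrow> ('o, 'm) cat \<Rightarrow> 'm square set \<Rightarrow> bool" where
  "stable_notion \<kappa> K I \<longleftrightarrow>
     independence_notion K I \<and> symmetric I \<and> transitive K I \<and> accessible_notion \<kappa> K I \<and>
     has_existence K I \<and> has_uniqueness K I"

end

theory Submission
  imports Defs
begin

text \<open>
  By existence and uniqueness, two notions agree as soon as every span \<open>B \<leftarrow> A \<rightarrow> C\<close> has one completion
  that is independent for both. To find it, iterate \<open>\<down>\<^sup>2\<close>-amalgamation with \<open>B\<close> to a chain of objects
  \<open>D i\<close> over \<open>A\<close> of large regular length, such that \<open>D j\<close> is \<open>\<down>\<^sup>2\<close>-independent over \<open>A\<close> from a copy of \<open>B\<close>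
  in \<open>D i\<close> for all \<open>j < i\<close>. Let \<open>M\<close> be its colimit and complete \<open>C \<leftarrow> A \<rightarrow> M\<close> to a \<open>\<down>\<^sup>1\<close>-independent
  square with corner \<open>N\<close>; by monotonicity \<open>C\<close> is \<open>\<down>\<^sup>1\<close>-independent from every copy of \<open>B\<close>. Accessibility of
  \<open>K\<^sub>\<down>\<close> for \<open>\<down>\<^sup>2\<close> yields a small \<open>X' \<rightarrow> Y'\<close>, independent from \<open>M \<rightarrow> N\<close>, through which \<open>A \<rightarrow> C\<close>
  factors. Being small, \<open>X'\<close> maps into some \<open>D i\<close>, so it is independent from the copies of \<open>B\<close> that are
  added later, and transitivity makes \<open>C\<close> \<open>\<down>\<^sup>2\<close>-independent from these as well.

  Only colimits in \<open>K\<^sub>\<down>\<close> are given. Identities embed \<open>K\<close> into \<open>K\<^sub>\<down>\<close> as a coreflective full subcategory, so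
  \<open>K\<close> inherits them, and then colimits in \<open>K\<^sub>\<down>\<close> turn out to be computed on domains and codomains.
\<close>


section \<open>Categories\<close>

lemma homI: "f \<in> Arr K \<Longrightarrow> f \<in> hom K (Dom K f) (Cod K f)"
  by (simp add: hom_def)

lemma homD:
  assumes "f \<in> hom K X Y"
  shows "f \<in> Arr K" "Dom K f = X" "Cod K f = Y"
  using assms by (auto simp: hom_def)

lemma (in category) hom_Obj:
  assumes "f \<in> hom K X Y"
  shows "X \<in> Obj K" "Y \<in> Obj K"
  using assms Dom_in_Obj Cod_in_Obj by (auto simp: hom_def)

lemma diagram_homD: "diagram K r D d \<Longrightarrow> (i, j) \<in> r \<Longrightarrow> d i j \<in> hom K (D i) (D j)"
  by (simp add: diagram_def)

lemma diagram_comp: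
  "diagram K r D d \<Longrightarrow> (i, j) \<in> r \<Longrightarrow> (j, k) \<in> r \<Longrightarrow> d i k = d j k \<cdot>\<^bsub>K\<^esub> d i j"
  unfolding diagram_def by blast

lemma cocone_homD: "cocone K r D d Y c \<Longrightarrow> i \<in> Field r \<Longrightarrow> c i \<in> hom K (D i) Y"
  by (simp add: cocone_def)

lemma cocone_comp: "cocone K r D d Y c \<Longrightarrow> (i, j) \<in> r \<Longrightarrow> c j \<cdot>\<^bsub>K\<^esub> d i j = c i"
  by (simp add: cocone_def)

lemma colimit_cocone: "colimit K r D d L c \<Longrightarrow> cocone K r D d L c"
  by (simp add: colimit_def)

lemma colimit_factor:
  assumes "colimit K r D d L c" "cocone K r D d Y b"
  obtains h where "h \<in> hom K L Y" "\<And>i. i \<in> Field r \<Longrightarrow> h \<cdot>\<^bsub>K\<^esub> c i = b i"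
  using assms unfolding colimit_def by blast

lemma (in category) cocone_extend:
  assumes c: "cocone K r D d L c" and dg: "diagram K r D d" and h: "h \<in> hom K L Y"
  shows "cocone K r D d Y (\<lambda>i. h \<cdot> c i)"
  unfolding cocone_def
proof (intro conjI ballI allI impI)
  show "Y \<in> Obj K" using h hom_Obj by blast
  show "h \<cdot> c i \<in> hom K (D i) Y" if "i \<in> Field r" for i
    using cocone_homD[OF c that] h Comp_in_hom by blast
  fix i j assume ij: "(i, j) \<in> r"
  have j: "j \<in> Field r" using ij by (auto simp: Field_def)
  show "h \<cdot> c j \<cdot> d i j = h \<cdot> c i"
    using Comp_assoc[OF diagram_homD[OF dg ij] cocone_homD[OF c j] h] cocone_comp[OF c ij] by simp
qed

lemma (in category) colimit_eqI:
  assumes col: "colimit K r D d L c" and dg: "diagram K r D d"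
    and u: "u \<in> hom K L Y" and v: "v \<in> hom K L Y"
    and eq: "\<And>i. i \<in> Field r \<Longrightarrow> u \<cdot> c i = v \<cdot> c i"
  shows "u = v"
proof -
  have "cocone K r D d Y (\<lambda>i. u \<cdot> c i)"
    using cocone_extend[OF colimit_cocone[OF col] dg u] .
  then have "\<exists>!h. h \<in> hom K L Y \<and> (\<forall>i \<in> Field r. h \<cdot> c i = u \<cdot> c i)"
    using col unfolding colimit_def by blast
  then show ?thesis using u v eq by metis
qed

text \<open>Since \<open>s\<close> carries the legs \<open>c\<close> to the colimit legs
  \<open>c'\<close>, the composite \<open>s \<cdot> h\<close> fixes every \<open>c' i\<close> and is
  therefore an identity; with \<open>hs\<close> this makes \<open>h\<close> an isomorphism of
  cocones. The proof transports factorizations along \<open>s\<close> and \<open>h\<close>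
  directly.\<close>

lemma (in category) colimit_iso:
  assumes col: "colimit K r D d L' c'" and dg: "diagram K r D d" and c: "cocone K r D d L c"
    and h: "h \<in> hom K L' L" and s: "s \<in> hom K L L'"
    and hs: "h \<cdot> s = Id K L" and hc: "\<And>i. i \<in> Field r \<Longrightarrow> s \<cdot> c i = c' i"
  shows "colimit K r D d L c"
  unfolding colimit_def
proof (intro conjI allI impI)
  show "cocone K r D d L c" by (rule c)
  have hc': "h \<cdot> c' i = c i" if "i \<in> Field r" for i
    using Comp_assoc[OF cocone_homD[OF c that] s h] hs hc[OF that]
      Id_Comp[OF cocone_homD[OF c that]] by simp
  fix Y b assume b: "cocone K r D d Y b"
  obtain k where k: "k \<in> hom K L' Y" "\<And>i. i \<in> Field r \<Longrightarrow> k \<cdot> c' i = b i"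
    using colimit_factor[OF col b] by blast
  have ks: "k \<cdot> s \<in> hom K L Y" using Comp_in_hom[OF s k(1)] .
  show "\<exists>!h. h \<in> hom K L Y \<and> (\<forall>i\<in>Field r. h \<cdot> c i = b i)"
  proof (rule ex1I[of _ "k \<cdot> s"], intro conjI ballI)
    show "k \<cdot> s \<in> hom K L Y" by (rule ks)
    show "k \<cdot> s \<cdot> c i = b i" if "i \<in> Field r" for i
      using Comp_assoc[OF cocone_homD[OF c that] s k(1)] hc[OF that] k(2)[OF that] by simp
  next
    fix g assume g: "g \<in> hom K L Y \<and> (\<forall>i\<in>Field r. g \<cdot> c i = b i)"
    have gh: "g \<cdot> h \<in> hom K L' Y" using Comp_in_hom[OF h] g by blast
    have "g \<cdot> h = k"
    proof (rule colimit_eqI[OF col dg gh k(1)])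
      fix i assume i: "i \<in> Field r"
      show "g \<cdot> h \<cdot> c' i = k \<cdot> c' i"
        using Comp_assoc[OF cocone_homD[OF colimit_cocone[OF col] i] h, of g Y] g hc'[OF i] k(2)[OF i] i
        by simp
    qed
    then have "k \<cdot> s = g \<cdot> (h \<cdot> s)" using Comp_assoc[OF s h, of g Y] g by simp
    then show "g = k \<cdot> s" using hs Comp_Id[of g L Y] g by simp
  qed
qed


section \<open>Presentability as a factorization property\<close>

text \<open>Unlike \<^const>\<open>presentable\<close>, this is relative to one given cocone, which need not be a colimit and
  whose index type is arbitrary.\<close>

definition tame ::
  "('o, 'm) cat \<Rightarrow> 'i rel \<Rightarrow> ('i \<Rightarrow> 'o) \<Rightarrow> ('i \<Rightarrow> 'i \<Rightarrow> 'm) \<Rightarrow> 'o \<Rightarrow> ('i \<Rightarrow> 'm) \<Rightarrow> 'o \<Rightarrow> bool" where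
  "tame K r D d L c X \<longleftrightarrow>
     (\<forall>h \<in> hom K X L. \<exists>i \<in> Field r. \<exists>g \<in> hom K X (D i). c i \<cdot>\<^bsub>K\<^esub> g = h) \<and>
     (\<forall>i \<in> Field r. \<forall>u \<in> hom K X (D i). \<forall>v \<in> hom K X (D i). c i \<cdot>\<^bsub>K\<^esub> u = c i \<cdot>\<^bsub>K\<^esub> v \<longrightarrow>
        (\<exists>j. (i, j) \<in> r \<and> d i j \<cdot>\<^bsub>K\<^esub> u = d i j \<cdot>\<^bsub>K\<^esub> v))"

lemma tame_factor:
  assumes "tame K r D d L c X" "h \<in> hom K X L"
  obtains i g where "i \<in> Field r" "g \<in> hom K X (D i)" "c i \<cdot>\<^bsub>K\<^esub> g = h"
  using assms unfolding tame_def by blast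

lemma tame_equalize:
  assumes "tame K r D d L c X" "i \<in> Field r" "u \<in> hom K X (D i)" "v \<in> hom K X (D i)"
    "c i \<cdot>\<^bsub>K\<^esub> u = c i \<cdot>\<^bsub>K\<^esub> v"
  obtains j where "(i, j) \<in> r" "d i j \<cdot>\<^bsub>K\<^esub> u = d i j \<cdot>\<^bsub>K\<^esub> v"
  using assms unfolding tame_def by blast

text \<open>Directedness for the successor cardinal of \<open>\<theta>\<close>, with a non-strict
  bound so that no successor has to be formed and \<open>\<theta>\<close> may live on its own
  type.\<close>

definition bounded_by :: "'v rel \<Rightarrow> 'i rel \<Rightarrow> bool" where
  "bounded_by \<theta> r \<longleftrightarrow> (\<forall>S \<subseteq> Field r. |S| \<le>o \<theta> \<longrightarrow> (\<exists>u \<in> Field r. \<forall>s \<in> S. (s, u) \<in> r))"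

lemma bounded_by_family:
  assumes "bounded_by \<theta> r" and "|A| \<le>o \<theta>" and "\<And>a. a \<in> A \<Longrightarrow> f a \<in> Field r"
  shows "\<exists>u \<in> Field r. \<forall>a \<in> A. (f a, u) \<in> r"
proof -
  have "|f ` A| \<le>o \<theta>" using card_of_image assms(2) ordLeq_transitive by blast
  moreover have "f ` A \<subseteq> Field r" using assms(3) by auto
  ultimately show ?thesis using assms(1) unfolding bounded_by_def by (metis imageI)
qed

lemma finite_ordLeq_Cinfinite: "finite A \<Longrightarrow> Cinfinite \<theta> \<Longrightarrow> |A| \<le>o \<theta>"
  by (rule ordLess_imp_ordLeq, rule Cfinite_ordLess_Cinfinite) (auto simp: cfinite_def Field_card_of card_of_card_order_on)

lemma bounded_by_pair:
  assumes "Cinfinite \<theta>" "bounded_by \<theta> r" "i \<in> Field r" "j \<in> Field r"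
  obtains u where "(i, u) \<in> r" "(j, u) \<in> r"
proof -
  have "|{i, j}| \<le>o \<theta>" by (rule finite_ordLeq_Cinfinite[OF _ assms(1)]) simp
  then obtain u where "\<forall>s \<in> {i, j}. (s, u) \<in> r"
    using assms(2-4) unfolding bounded_by_def by (metis empty_subsetI insert_subset)
  then show ?thesis using that[of u] by blast
qed

text \<open>The relative form of the fact that small colimits of presentable objects are
  presentable. Each leg composed with \<open>h\<close> factors through some stage; the at most
  \<open>\<theta>\<close> stages, and then the stages at which the compatibility equations hold,
  have common bounds, so the factorizations glue to an arrow out of the colimit.\<close>

lemma (in category) tame_colimit:
  fixes \<theta> :: "'v rel"
  assumes th: "Cinfinite \<theta>"
    and dg: "diagram K r D d" and c: "cocone K r D d L c" and bd: "bounded_by \<theta> r" and tr: "trans r"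
    and R: "|Field R| \<le>o \<theta>" and dgX: "diagram K R X x" and col: "colimit K R X x X' x'"
    and tm: "\<And>a. a \<in> Field R \<Longrightarrow> tame K r D d L c (X a)"
  shows "tame K r D d L c X'"
  unfolding tame_def
proof (intro conjI ballI impI)
  have x': "x' a \<in> hom K (X a) X'" if "a \<in> Field R" for a
    using cocone_homD[OF colimit_cocone[OF col] that] .
  have ci: "c i \<in> hom K (D i) L" if "i \<in> Field r" for i using cocone_homD[OF c that] .
  have FI: "i \<in> Field r" "j \<in> Field r" if "(i, j) \<in> r" for i j using that by (auto simp: Field_def)
  have RI: "i \<in> Field R" "j \<in> Field R" if "(i, j) \<in> R" for i j using that by (auto simp: Field_def)
  fix h assume h: "h \<in> hom K X' L"
  have "\<exists>i g. i \<in> Field r \<and> g \<in> hom K (X a) (D i) \<and> c i \<cdot> g = h \<cdot> x' a" if "a \<in> Field R" for a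
    using tame_factor[OF tm[OF that] Comp_in_hom[OF x'[OF that] h]] by metis
  then obtain i g where ig: "\<And>a. a \<in> Field R \<Longrightarrow> i a \<in> Field r \<and> g a \<in> hom K (X a) (D (i a)) \<and> c (i a) \<cdot> g a = h \<cdot> x' a"
    by metis
  \<comment> \<open>All factorizations are moved to one stage \<open>i0\<close>. There they are
    compatible only after composing with \<open>c i0\<close>.\<close>
  obtain i0 where i0: "i0 \<in> Field r" "\<And>a. a \<in> Field R \<Longrightarrow> (i a, i0) \<in> r"
    using bounded_by_family[OF bd R, of i] ig by blast
  define g' where "g' a = d (i a) i0 \<cdot> g a" for a
  have g': "g' a \<in> hom K (X a) (D i0)" "c i0 \<cdot> g' a = h \<cdot> x' a" if "a \<in> Field R" for a
  proof -
    have 1: "g a \<in> hom K (X a) (D (i a))" "d (i a) i0 \<in> hom K (D (i a)) (D i0)"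
      using ig[OF that] diagram_homD[OF dg i0(2)[OF that]] by auto
    show "g' a \<in> hom K (X a) (D i0)" unfolding g'_def using Comp_in_hom[OF 1] .
    show "c i0 \<cdot> g' a = h \<cdot> x' a" unfolding g'_def
      using Comp_assoc[OF 1 ci[OF i0(1)]] cocone_comp[OF c i0(2)[OF that]] ig[OF that] by simp
  qed
  have "\<exists>j. (i0, j) \<in> r \<and> d i0 j \<cdot> (g' b \<cdot> x a b) = d i0 j \<cdot> g' a" if ab: "(a, b) \<in> R" for a b
  proof -
    note a = RI(1)[OF ab] and b = RI(2)[OF ab]
    have xab: "x a b \<in> hom K (X a) (X b)" using diagram_homD[OF dgX ab] .
    have "c i0 \<cdot> (g' b \<cdot> x a b) = h \<cdot> x' b \<cdot> x a b"
      using Comp_assoc[OF xab g'(1)[OF b] ci[OF i0(1)]] g'(2)[OF b] by simp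
    also have "\<dots> = h \<cdot> x' a"
      using Comp_assoc[OF xab x'[OF b] h] cocone_comp[OF colimit_cocone[OF col] ab] by simp
    finally have "c i0 \<cdot> (g' b \<cdot> x a b) = c i0 \<cdot> g' a" using g'(2)[OF a] by simp
    then show ?thesis
      using tame_equalize[OF tm[OF a] i0(1) Comp_in_hom[OF xab g'(1)[OF b]] g'(1)[OF a]] by metis
  qed
  then obtain j where j: "\<And>a b. (a, b) \<in> R \<Longrightarrow> (i0, j a b) \<in> r \<and> d i0 (j a b) \<cdot> (g' b \<cdot> x a b) = d i0 (j a b) \<cdot> g' a"
    by metis
  \<comment> \<open>There is one compatibility equation for each pair in \<open>R\<close>, and there
    are at most \<open>\<theta>\<close> pairs, so one stage \<open>u1\<close> serves them
    all.\<close>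
  have "|Field R \<times> Field R| \<le>o \<theta>"
    using card_of_Times_ordLeq_infinite_Field[OF _ R R] th unfolding cinfinite_def by blast
  then have R': "|R| \<le>o \<theta>" using card_of_mono1[of R "Field R \<times> Field R"] ordLeq_transitive
    by (metis FieldI1 FieldI2 SigmaI subrelI)
  obtain u1 where u1: "u1 \<in> Field r" "\<And>p. p \<in> R \<Longrightarrow> (j (fst p) (snd p), u1) \<in> r"
  proof -
    have "j (fst p) (snd p) \<in> Field r" if "p \<in> R" for p using j[of "fst p" "snd p"] that FI by auto
    then show thesis using bounded_by_family[OF bd R', of "\<lambda>p. j (fst p) (snd p)"] that by blast
  qed
  obtain u where u: "(i0, u) \<in> r" "(u1, u) \<in> r" using bounded_by_pair[OF th bd i0(1) u1(1)] .
  note uF = FI(2)[OF u(1)]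
  define k where "k a = d i0 u \<cdot> g' a" for a
  have "cocone K R X x (D u) k"
    unfolding cocone_def
  proof (intro conjI ballI allI impI)
    show "D u \<in> Obj K" using dg uF unfolding diagram_def by blast
    show "k a \<in> hom K (X a) (D u)" if "a \<in> Field R" for a
      unfolding k_def using Comp_in_hom[OF g'(1)[OF that] diagram_homD[OF dg u(1)]] .
    fix a b assume ab: "(a, b) \<in> R"
    note a = RI(1)[OF ab] and b = RI(2)[OF ab]
    note jab = j[OF ab, THEN conjunct1] j[OF ab, THEN conjunct2]
    have xab: "x a b \<in> hom K (X a) (X b)" using diagram_homD[OF dgX ab] .
    have ju: "(j a b, u) \<in> r" using transD[OF tr u1(2)[OF ab] u(2)] by simp
    have du: "d i0 u = d (j a b) u \<cdot> d i0 (j a b)"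
      using diagram_comp[OF dg jab(1) ju] .
    have w: "d i0 u \<cdot> w = d (j a b) u \<cdot> (d i0 (j a b) \<cdot> w)" if "w \<in> hom K (X a) (D i0)" for w
      using Comp_assoc[OF that diagram_homD[OF dg jab(1)] diagram_homD[OF dg ju]] du by simp
    show "k b \<cdot> x a b = k a" unfolding k_def
      using Comp_assoc[OF xab g'(1)[OF b] diagram_homD[OF dg u(1)]]
        w[OF Comp_in_hom[OF xab g'(1)[OF b]]] w[OF g'(1)[OF a]] jab(2) by simp
  qed
  then obtain h' where h': "h' \<in> hom K X' (D u)" "\<And>a. a \<in> Field R \<Longrightarrow> h' \<cdot> x' a = k a"
    using colimit_factor[OF col] by blast
  have "c u \<cdot> h' = h"
  proof (rule colimit_eqI[OF col dgX _ h])
    show "c u \<cdot> h' \<in> hom K X' L" using Comp_in_hom[OF h'(1) ci[OF uF]] .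
    fix a assume a: "a \<in> Field R"
    show "c u \<cdot> h' \<cdot> x' a = h \<cdot> x' a"
      using Comp_assoc[OF x'[OF a] h'(1) ci[OF uF]] h'(2)[OF a] g'[OF a] k_def
        Comp_assoc[OF g'(1)[OF a] diagram_homD[OF dg u(1)] ci[OF uF]] cocone_comp[OF c u(1)] by simp
  qed
  then show "\<exists>i\<in>Field r. \<exists>g\<in>hom K X' (D i). c i \<cdot> g = h" using h'(1) uF by blast
next
  have x': "x' a \<in> hom K (X a) X'" if "a \<in> Field R" for a
    using cocone_homD[OF colimit_cocone[OF col] that] .
  fix i u v
  assume i: "i \<in> Field r" and u: "u \<in> hom K X' (D i)" and v: "v \<in> hom K X' (D i)"
    and eq: "c i \<cdot> u = c i \<cdot> v"
  have ci: "c i \<in> hom K (D i) L" using cocone_homD[OF c i] .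
  have "\<exists>j. (i, j) \<in> r \<and> d i j \<cdot> (u \<cdot> x' a) = d i j \<cdot> (v \<cdot> x' a)" if a: "a \<in> Field R" for a
  proof -
    have "c i \<cdot> (u \<cdot> x' a) = c i \<cdot> (v \<cdot> x' a)"
      using Comp_assoc[OF x'[OF a] u ci] Comp_assoc[OF x'[OF a] v ci] eq by simp
    then show ?thesis
      using tame_equalize[OF tm[OF a] i Comp_in_hom[OF x'[OF a] u] Comp_in_hom[OF x'[OF a] v]] by metis
  qed
  \<comment> \<open>Arrows out of \<open>X'\<close> are determined by the legs, so it suffices to
    equalize on each leg and to bound the stages \<open>j a\<close>.\<close>
  then obtain j where j: "\<And>a. a \<in> Field R \<Longrightarrow> (i, j a) \<in> r \<and> d i (j a) \<cdot> (u \<cdot> x' a) = d i (j a) \<cdot> (v \<cdot> x' a)"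
    by metis
  obtain m1 where m1: "m1 \<in> Field r" "\<And>a. a \<in> Field R \<Longrightarrow> (j a, m1) \<in> r"
  proof -
    have "j a \<in> Field r" if "a \<in> Field R" for a using j[OF that] by (auto simp: Field_def)
    then show thesis using bounded_by_family[OF bd R, of j] that by blast
  qed
  obtain m where m: "(i, m) \<in> r" "(m1, m) \<in> r" using bounded_by_pair[OF th bd i m1(1)] .
  have dim: "d i m \<in> hom K (D i) (D m)" using diagram_homD[OF dg m(1)] .
  have "d i m \<cdot> u = d i m \<cdot> v"
  proof (rule colimit_eqI[OF col dgX Comp_in_hom[OF u dim] Comp_in_hom[OF v dim]])
    fix a assume a: "a \<in> Field R"
    have ja: "(i, j a) \<in> r" "(j a, m) \<in> r" using j[OF a] m1(2)[OF a] m(2) transD[OF tr] by blast+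
    have w: "d i m \<cdot> w = d (j a) m \<cdot> (d i (j a) \<cdot> w)" if "w \<in> hom K (X a) (D i)" for w
      using diagram_comp[OF dg ja] Comp_assoc[OF that diagram_homD[OF dg ja(1)] diagram_homD[OF dg ja(2)]] by simp
    show "d i m \<cdot> u \<cdot> x' a = d i m \<cdot> v \<cdot> x' a"
      using Comp_assoc[OF x'[OF a] u dim] Comp_assoc[OF x'[OF a] v dim]
        w[OF Comp_in_hom[OF x'[OF a] u]] w[OF Comp_in_hom[OF x'[OF a] v]] j[OF a] by simp
  qed
  then show "\<exists>j. (i, j) \<in> r \<and> d i j \<cdot> u = d i j \<cdot> v" using m(1) by blast
qed

lemma directed_poset_pair:
  assumes "Cinfinite \<mu>" "directed_poset \<mu> r" "i \<in> Field r" "j \<in> Field r"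
  obtains u where "(i, u) \<in> r" "(j, u) \<in> r"
proof -
  have "|{i, j}| <o \<mu>"
    by (rule Cfinite_ordLess_Cinfinite[OF _ assms(1)]) (auto simp: cfinite_def Field_card_of card_of_card_order_on)
  then have "\<exists>u \<in> Field r. \<forall>s \<in> {i, j}. (s, u) \<in> r"
    using assms(2-4) unfolding directed_poset_def by (metis empty_subsetI insert_subset)
  then show ?thesis using that by blast
qed

lemma directed_poset_refl: "directed_poset \<mu> r \<Longrightarrow> i \<in> Field r \<Longrightarrow> (i, i) \<in> r"
  by (simp add: directed_poset_def partial_order_on_def preorder_on_def refl_on_def)

lemma directed_poset_trans: "directed_poset \<mu> r \<Longrightarrow> (i, j) \<in> r \<Longrightarrow> (j, k) \<in> r \<Longrightarrow> (i, k) \<in> r"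
  unfolding directed_poset_def partial_order_on_def preorder_on_def by (meson transD)

lemma inaccessible_Cinfinite:
  assumes "inaccessible \<kappa>"
  shows "Cinfinite \<kappa>"
proof -
  have "Card_order \<kappa>" "natLeq \<le>o \<kappa>" using assms by (auto simp: inaccessible_def ordLess_imp_ordLeq)
  then show ?thesis using cinfinite_mono natLeq_cinfinite by blast
qed

lemma small_finite: "inaccessible \<kappa> \<Longrightarrow> finite A \<Longrightarrow> small \<kappa> A"
  unfolding small_def by (rule Cfinite_ordLess_Cinfinite[OF _ inaccessible_Cinfinite])
    (auto simp: cfinite_def Field_card_of card_of_card_order_on)

text \<open>Cocones with values in a two-element set already detect both halves of the factorization
  property.\<close>

lemma presentable_tame:
  fixes \<kappa> \<mu> r :: "'u rel"
  assumes "inaccessible \<kappa>" and E: "category E" and \<mu>: "Cinfinite \<mu>"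
    and pr: "presentable \<kappa> \<mu> E X"
    and r: "directed_poset \<mu> r" "small \<kappa> (Field r)" and dg: "diagram E r D d" and col: "colimit E r D d L c"
  shows "tame E r D d L c X"
proof -
  interpret category E by (rule E)
  have "infinite (Field \<kappa>)" using inaccessible_Cinfinite[OF assms(1)] by (simp add: cinfinite_def)
  then have "infinite (UNIV :: 'u set)" using infinite_super[OF subset_UNIV, of "Field \<kappa>"] by simp
  then obtain x y :: 'u where xy: "x \<noteq> y" using ex_new_if_finite[of "{undefined}"] by auto
  have S: "small \<kappa> {x, y}" by (rule small_finite[OF assms(1)]) simp
  have univ: "\<exists>!\<psi>. \<psi> \<in> hom E X L \<rightarrow>\<^sub>E {x, y} \<and>
                 (\<forall>i \<in> Field r. \<forall>g \<in> hom E X (D i). \<psi> (c i \<cdot>\<^bsub>E\<^esub> g) = \<phi> i g)"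
    if "\<forall>i \<in> Field r. \<phi> i \<in> hom E X (D i) \<rightarrow> {x, y}"
      "\<forall>i j. (i, j) \<in> r \<longrightarrow> (\<forall>g \<in> hom E X (D i). \<phi> j (d i j \<cdot>\<^bsub>E\<^esub> g) = \<phi> i g)" for \<phi>
    using pr r dg col S that unfolding presentable_def by blast
  show ?thesis
    unfolding tame_def
  proof (intro conjI ballI impI)
    fix h assume h: "h \<in> hom E X L"
    show "\<exists>i\<in>Field r. \<exists>g\<in>hom E X (D i). c i \<cdot>\<^bsub>E\<^esub> g = h"
    proof (rule ccontr)
      assume no: "\<not> ?thesis"
      \<comment> \<open>The two functions differ at \<open>h\<close> alone. If no leg reaches
        \<open>h\<close>, both are induced by the constant cocone, against uniqueness.\<close>
      define \<psi>1 where "\<psi>1 = restrict (\<lambda>_. x) (hom E X L)"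
      define \<psi>2 where "\<psi>2 = restrict (\<lambda>k. if k = h then y else x) (hom E X L)"
      have cg: "c i \<cdot>\<^bsub>E\<^esub> g \<in> hom E X L" if "i \<in> Field r" "g \<in> hom E X (D i)" for i g
        using Comp_in_hom[OF that(2) cocone_homD[OF colimit_cocone[OF col] that(1)]] .
      have "\<psi>1 \<in> hom E X L \<rightarrow>\<^sub>E {x, y} \<and>
                 (\<forall>i \<in> Field r. \<forall>g \<in> hom E X (D i). \<psi>1 (c i \<cdot>\<^bsub>E\<^esub> g) = x)"
        unfolding \<psi>1_def using cg by auto
      moreover have "\<psi>2 \<in> hom E X L \<rightarrow>\<^sub>E {x, y} \<and>
                 (\<forall>i \<in> Field r. \<forall>g \<in> hom E X (D i). \<psi>2 (c i \<cdot>\<^bsub>E\<^esub> g) = x)"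
        unfolding \<psi>2_def using cg no by auto
      ultimately have "\<psi>1 = \<psi>2" using univ[of "\<lambda>_ _. x"] by auto
      then have "\<psi>1 h = \<psi>2 h" by simp
      then show False using h xy by (simp add: \<psi>1_def \<psi>2_def)
    qed
  next
    fix i u v
    assume i: "i \<in> Field r" and u: "u \<in> hom E X (D i)" and v: "v \<in> hom E X (D i)"
      and eq: "c i \<cdot>\<^bsub>E\<^esub> u = c i \<cdot>\<^bsub>E\<^esub> v"
    \<comment> \<open>\<open>Q j g\<close> says that \<open>g\<close> and \<open>u\<close> become
      equal at some later stage, so \<open>\<phi>\<close> is the characteristic function of the
      class of \<open>u\<close> in the colimit of the hom sets.\<close>
    define Q where "Q j g \<longleftrightarrow> (\<exists>k. (i, k) \<in> r \<and> (j, k) \<in> r \<and> d i k \<cdot>\<^bsub>E\<^esub> u = d j k \<cdot>\<^bsub>E\<^esub> g)" for j g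
    define \<phi> where "\<phi> j g = (if Q j g then x else y)" for j g
    have step: "d j k \<cdot>\<^bsub>E\<^esub> g = d l k \<cdot>\<^bsub>E\<^esub> (d j l \<cdot>\<^bsub>E\<^esub> g)"
      if "(j, l) \<in> r" "(l, k) \<in> r" "g \<in> hom E X (D j)" for j k l g
      using diagram_comp[OF dg that(1,2)]
        Comp_assoc[OF that(3) diagram_homD[OF dg that(1)] diagram_homD[OF dg that(2)]] by simp
    have "Q j' (d j j' \<cdot>\<^bsub>E\<^esub> g) \<longleftrightarrow> Q j g" if jj': "(j, j') \<in> r" and g: "g \<in> hom E X (D j)" for j j' g
    proof
      assume "Q j' (d j j' \<cdot>\<^bsub>E\<^esub> g)"
      then obtain k where k: "(i, k) \<in> r" "(j', k) \<in> r" "d i k \<cdot>\<^bsub>E\<^esub> u = d j' k \<cdot>\<^bsub>E\<^esub> (d j j' \<cdot>\<^bsub>E\<^esub> g)"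
        unfolding Q_def by blast
      then show "Q j g" unfolding Q_def
        using step[OF jj' k(2) g] directed_poset_trans[OF r(1) jj' k(2)] by metis
    next
      assume "Q j g"
      then obtain k where k: "(i, k) \<in> r" "(j, k) \<in> r" "d i k \<cdot>\<^bsub>E\<^esub> u = d j k \<cdot>\<^bsub>E\<^esub> g"
        unfolding Q_def by blast
      have "k \<in> Field r" "j' \<in> Field r" using k jj' by (auto simp: Field_def)
      then obtain l where l: "(k, l) \<in> r" "(j', l) \<in> r" using directed_poset_pair[OF \<mu> r(1)] by blast
      have "d i l \<cdot>\<^bsub>E\<^esub> u = d j' l \<cdot>\<^bsub>E\<^esub> (d j j' \<cdot>\<^bsub>E\<^esub> g)"
        using step[OF k(1) l(1) u] step[OF k(2) l(1) g] step[OF jj' l(2) g] k(3) by simp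
      then show "Q j' (d j j' \<cdot>\<^bsub>E\<^esub> g)" unfolding Q_def
        using l(2) directed_poset_trans[OF r(1) k(1) l(1)] by blast
    qed
    then have "\<exists>!\<psi>. \<psi> \<in> hom E X L \<rightarrow>\<^sub>E {x, y} \<and>
                 (\<forall>i \<in> Field r. \<forall>g \<in> hom E X (D i). \<psi> (c i \<cdot>\<^bsub>E\<^esub> g) = \<phi> i g)"
      by (intro univ) (auto simp: \<phi>_def)
    then obtain \<psi> where "\<forall>i \<in> Field r. \<forall>g \<in> hom E X (D i). \<psi> (c i \<cdot>\<^bsub>E\<^esub> g) = \<phi> i g" by blast
    then have "\<phi> i u = \<phi> i v" using i u v eq by metis
    moreover have "Q i u" unfolding Q_def using directed_poset_refl[OF r(1) i] by blast
    ultimately have "Q i v" using xy by (auto simp: \<phi>_def split: if_splits)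
    then show "\<exists>j. (i, j) \<in> r \<and> d i j \<cdot>\<^bsub>E\<^esub> u = d i j \<cdot>\<^bsub>E\<^esub> v" unfolding Q_def by blast
  qed
qed


section \<open>Independence notions\<close>

lemma comm_squaresI:
  assumes "ab \<in> hom K A B" "ac \<in> hom K A C" "bd \<in> hom K B D" "cd \<in> hom K C D"
    "bd \<cdot>\<^bsub>K\<^esub> ab = cd \<cdot>\<^bsub>K\<^esub> ac"
  shows "(ab, ac, bd, cd) \<in> comm_squares K"
  using assms unfolding comm_squares_def by blast

lemma indepD:
  assumes "independence_notion K I" "(ab, ac, bd, cd) \<in> I"
  shows "ab \<in> hom K (Dom K ab) (Cod K ab)" "ac \<in> hom K (Dom K ab) (Dom K cd)"
    "bd \<in> hom K (Cod K ab) (Cod K cd)" "cd \<in> hom K (Dom K cd) (Cod K cd)"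
    "bd \<cdot>\<^bsub>K\<^esub> ab = cd \<cdot>\<^bsub>K\<^esub> ac"
proof -
  have "(ab, ac, bd, cd) \<in> comm_squares K" using assms unfolding independence_notion_def by blast
  then show "ab \<in> hom K (Dom K ab) (Cod K ab)" "ac \<in> hom K (Dom K ab) (Dom K cd)"
    "bd \<in> hom K (Cod K ab) (Cod K cd)" "cd \<in> hom K (Dom K cd) (Cod K cd)"
    "bd \<cdot>\<^bsub>K\<^esub> ab = cd \<cdot>\<^bsub>K\<^esub> ac"
    by (auto simp: comm_squares_def hom_def)
qed

lemma indep_extend:
  assumes "independence_notion K I" "(ab, ac, bd, cd) \<in> I" "e \<in> hom K (Cod K cd) E"
  shows "(ab, ac, e \<cdot>\<^bsub>K\<^esub> bd, e \<cdot>\<^bsub>K\<^esub> cd) \<in> I"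
proof -
  have "Cod K bd = Cod K cd" using indepD(3)[OF assms(1,2)] by (auto simp: hom_def)
  then show ?thesis using assms unfolding independence_notion_def by (auto simp: hom_def)
qed

lemma indep_restrict:
  assumes "independence_notion K I" "(ab, ac, e \<cdot>\<^bsub>K\<^esub> bd, e \<cdot>\<^bsub>K\<^esub> cd) \<in> I"
    "(ab, ac, bd, cd) \<in> comm_squares K" "e \<in> hom K (Cod K cd) E"
  shows "(ab, ac, bd, cd) \<in> I"
proof -
  have "Cod K bd = Cod K cd" using assms(3) by (auto simp: comm_squares_def hom_def)
  then show ?thesis using assms unfolding independence_notion_def by (auto simp: hom_def)
qed

section \<open>Monotonicity from transitivity\<close>

text \<open>Amalgamate in two steps, first along \<open>ac\<close>, then along \<open>cc'\<close>.
  By transitivity the composite is independent, so uniqueness joins it to the given square in a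
  common corner \<open>G\<close>. The first of the two steps, extended to \<open>G\<close>, agrees
  there with the square in question, and independence descends from \<open>G\<close>.\<close>

lemma (in category) right_monotonicI:
  assumes I: "independence_notion K I" and ex: "has_existence K I" and un: "has_uniqueness K I"
    and tr: "right_transitive K I"
  shows "right_monotonic K I"
  unfolding right_monotonic_def
proof (intro allI ballI impI)
  fix ab bd ac cc' c'd
  assume A: "ac \<in> Arr K" "cc' \<in> Arr K" "c'd \<in> Arr K" "Cod K ac = Dom K cc'" "Cod K cc' = Dom K c'd"
    and sq: "(ab, cc' \<cdot> ac, bd, c'd) \<in> I"
  have ac: "ac \<in> hom K (Dom K ac) (Dom K cc')" and cc': "cc' \<in> hom K (Dom K cc') (Dom K c'd)"
    and c'd: "c'd \<in> hom K (Dom K c'd) (Cod K c'd)" using A by (auto simp: hom_def)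
  note sqD = indepD[OF I sq]
  have da: "Dom K ab = Dom K ac" using homD(2)[OF Comp_in_hom[OF ac cc']] homD(2)[OF sqD(2)] by simp
  obtain be ce where e: "(ab, ac, be, ce) \<in> I"
    using ex A(1) homD(1)[OF sqD(1)] da unfolding has_existence_def by metis
  note eD = indepD[OF I e]
  have ce: "ce \<in> hom K (Dom K cc') (Cod K ce)" using eD(2,4) ac by (auto simp: hom_def)
  obtain ef c'f where f: "(ce, cc', ef, c'f) \<in> I"
    using ex homD(1)[OF cc'] homD(1)[OF ce] homD(2)[OF ce] unfolding has_existence_def by metis
  note fD = indepD[OF I f]
  have c'f: "c'f \<in> hom K (Dom K c'd) (Cod K c'f)" using fD(2,4) cc' by (auto simp: hom_def)
  have ef: "ef \<in> hom K (Cod K ce) (Cod K c'f)" using fD(3) by simp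
  have be: "be \<in> hom K (Cod K ab) (Cod K ce)" using eD(3) by simp
  have g: "(ab, cc' \<cdot> ac, ef \<cdot> be, c'f) \<in> I"
    using tr e f unfolding right_transitive_def by blast
  obtain G e1 e2 where G: "e1 \<in> hom K (Cod K bd) G" "e2 \<in> hom K (Cod K (ef \<cdot> be)) G"
    "e1 \<cdot> bd = e2 \<cdot> (ef \<cdot> be)" "e1 \<cdot> c'd = e2 \<cdot> c'f"
    using un sq g unfolding has_uniqueness_def by blast
  have bd: "bd \<in> hom K (Cod K ab) (Cod K c'd)" using sqD(3) by simp
  have e1: "e1 \<in> hom K (Cod K c'd) G" using G(1) homD(3)[OF bd] by simp
  have e2: "e2 \<in> hom K (Cod K c'f) G" using G(2) homD(3)[OF Comp_in_hom[OF be ef]] by simp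
  have "(ab, ac, (e2 \<cdot> ef) \<cdot> be, (e2 \<cdot> ef) \<cdot> ce) \<in> I"
    using indep_extend[OF I e Comp_in_hom[OF ef e2]] .
  moreover have "(e2 \<cdot> ef) \<cdot> be = e1 \<cdot> bd" using Comp_assoc[OF be ef e2] G(3) by simp
  moreover have "(e2 \<cdot> ef) \<cdot> ce = e1 \<cdot> (c'd \<cdot> cc')"
    using Comp_assoc[OF ce ef e2] fD(5) Comp_assoc[OF cc' c'f e2] Comp_assoc[OF cc' c'd e1] G(4) by simp
  ultimately have ext: "(ab, ac, e1 \<cdot> bd, e1 \<cdot> (c'd \<cdot> cc')) \<in> I" by simp
  show "(ab, ac, bd, c'd \<cdot> cc') \<in> I"
  proof (rule indep_restrict[OF I ext])
    show "e1 \<in> hom K (Cod K (c'd \<cdot> cc')) G" using e1 homD(3)[OF Comp_in_hom[OF cc' c'd]] by simp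
    show "(ab, ac, bd, c'd \<cdot> cc') \<in> comm_squares K"
      using comm_squaresI[OF sqD(1) _ bd Comp_in_hom[OF cc' c'd], of ac] ac da sqD(5)
        Comp_assoc[OF ac cc' c'd] by simp
  qed
qed

section \<open>Passage to the dual notion\<close>

lemma dual_independence_notion:
  assumes "independence_notion K I"
  shows "independence_notion K (dual I)"
  unfolding independence_notion_def
proof (intro conjI allI impI ballI)
  show "dual I \<subseteq> comm_squares K"
  proof
    fix s assume "s \<in> dual I"
    then obtain ab ac bd cd where s: "s = (ab, ac, bd, cd)" "(ac, ab, cd, bd) \<in> I" by (auto simp: dual_def)
    then have "(ac, ab, cd, bd) \<in> comm_squares K" using assms unfolding independence_notion_def by blast
    then show "s \<in> comm_squares K" unfolding s comm_squares_def by force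
  qed
  fix ab ac bd cd e
  assume a: "(ab, ac, bd, cd) \<in> comm_squares K" "e \<in> Arr K" "Dom K e = Cod K bd"
  then have "(ac, ab, cd, bd) \<in> comm_squares K" "Dom K e = Cod K cd"
    by (force simp: comm_squares_def hom_def)+
  then show "((ab, ac, bd, cd) \<in> dual I) = ((ab, ac, e \<cdot>\<^bsub>K\<^esub> bd, e \<cdot>\<^bsub>K\<^esub> cd) \<in> dual I)"
    using assms a(2) unfolding independence_notion_def dual_def by auto
qed

lemma dual_has_existence: "has_existence K I \<Longrightarrow> has_existence K (dual I)"
  unfolding has_existence_def dual_def mem_Collect_eq case_prod_conv by (intro ballI impI) (metis (no_types))

lemma dual_has_uniqueness: 
  assumes "independence_notion K I" "has_uniqueness K I"
  shows "has_uniqueness K (dual I)"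
  unfolding has_uniqueness_def
proof (intro allI impI)
  fix ab ac bd1 cd1 bd2 cd2 assume "(ab, ac, bd1, cd1) \<in> dual I" "(ab, ac, bd2, cd2) \<in> dual I"
  then have i: "(ac, ab, cd1, bd1) \<in> I" "(ac, ab, cd2, bd2) \<in> I" by (auto simp: dual_def)
  have "Cod K bd1 = Cod K cd1" "Cod K bd2 = Cod K cd2"
    using indepD(3)[OF assms(1) i(1)] indepD(3)[OF assms(1) i(2)] by (auto simp: hom_def)
  then show "\<exists>D. \<exists>e1\<in>hom K (Cod K bd1) D. \<exists>e2\<in>hom K (Cod K bd2) D.
          e1 \<cdot>\<^bsub>K\<^esub> bd1 = e2 \<cdot>\<^bsub>K\<^esub> bd2 \<and> e1 \<cdot>\<^bsub>K\<^esub> cd1 = e2 \<cdot>\<^bsub>K\<^esub> cd2"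
    using assms(2)[unfolded has_uniqueness_def, rule_format, OF i] by auto
qed

section \<open>The category of independent squares\<close>

text \<open>The action on arrows of the domain functor from \<open>indep_cat K I\<close> to
  \<open>K\<close>; \<open>upper\<close> is that of the codomain functor.\<close>

definition lower :: "'m square \<Rightarrow> 'm" where "lower s = fst (snd s)"

definition upper :: "'m square \<Rightarrow> 'm" where "upper s = fst (snd (snd s))"

lemma lower_simp [simp]: "lower (ab, ac, bd, cd) = ac" by (simp add: lower_def)

lemma upper_simp [simp]: "upper (ab, ac, bd, cd) = bd" by (simp add: upper_def)

text \<open>The last assumption is part of right accessibility. It contains the independence of the
  identity squares \<open>(f, id, id, f)\<close>, which is used for colimits of squares.\<close>

locale independence = category K for K :: "('o, 'm) cat" (structure) +
  fixes I :: "'m square set"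
  assumes notion: "independence_notion K I"
    and existence: "has_existence K I"
    and uniqueness: "has_uniqueness K I"
    and trans: "transitive K I"
    and category_indep_cat: "category (indep_cat K I)"
begin

abbreviation E where "E \<equiv> indep_cat K I"

sublocale E: category E by (rule category_indep_cat)

lemma monotonic:
  assumes "(ab, cc' \<cdot> ac, bd, c'd) \<in> I" "ac \<in> hom K A C" "cc' \<in> hom K C C'" "c'd \<in> hom K C' D"
  shows "(ab, ac, bd, c'd \<cdot> cc') \<in> I"
proof -
  have "right_monotonic K I"
    by (rule right_monotonicI[OF notion existence uniqueness]) (use trans transitive_def in blast)
  then show ?thesis unfolding right_monotonic_def
    using assms(1) homD[OF assms(2)] homD[OF assms(3)] homD[OF assms(4)] by metis
qed

lemma left_monotonic:
  assumes "(bb' \<cdot> ab, ac, b'd, cd) \<in> I" "ab \<in> hom K A B" "bb' \<in> hom K B B'" "b'd \<in> hom K B' D"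
  shows "(ab, ac, b'd \<cdot> bb', cd) \<in> I"
proof -
  have "right_monotonic K (dual I)"
    by (rule right_monotonicI[OF dual_independence_notion[OF notion] dual_has_existence[OF existence]
        dual_has_uniqueness[OF notion uniqueness]]) (use trans transitive_def left_transitive_def in blast)
  moreover have "(ac, bb' \<cdot> ab, cd, b'd) \<in> dual I" using assms(1) by (simp add: dual_def)
  ultimately have "(ac, ab, cd, b'd \<cdot> bb') \<in> dual I" unfolding right_monotonic_def
    using homD[OF assms(2)] homD[OF assms(3)] homD[OF assms(4)] by metis
  then show ?thesis by (simp add: dual_def)
qed

text \<open>Left transitivity with the dual unfolded: squares paste vertically along a shared
  horizontal edge.\<close>

lemma stack:
  assumes "(ab, ac, bd, cd) \<in> I" "(be, bd, ef, df) \<in> I"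
  shows "(be \<cdot> ab, ac, ef, df \<cdot> cd) \<in> I"
proof -
  have "right_transitive K (dual I)" using trans by (simp add: transitive_def left_transitive_def)
  moreover have "(ac, ab, cd, bd) \<in> dual I" "(bd, be, df, ef) \<in> dual I" using assms by (auto simp: dual_def)
  ultimately have "(ac, be \<cdot> ab, df \<cdot> cd, ef) \<in> dual I" unfolding right_transitive_def by blast
  then show ?thesis by (simp add: dual_def)
qed

lemma Obj_E [simp]: "Obj E = Arr K" by (simp add: indep_cat_def)

lemma Comp_E [simp]: "(cd, ce, df, ef) \<cdot>\<^bsub>E\<^esub> (ab, ac, bd, cd') = (ab, ce \<cdot> ac, df \<cdot> bd, ef)"
  by (simp add: indep_cat_def)

lemma Id_E: "Id E f = (f, Id K (Dom K f), Id K (Cod K f), f)" by (simp add: indep_cat_def)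

lemma hom_E: "s \<in> hom E f g \<longleftrightarrow> s = (f, lower s, upper s, g) \<and> s \<in> I"
  by (cases s) (auto simp: hom_def indep_cat_def)

lemma hom_E_I: "(f, a, b, g) \<in> I \<Longrightarrow> (f, a, b, g) \<in> hom E f g"
  by (simp add: hom_E)

lemma hom_ED:
  assumes "s \<in> hom E f g"
  shows "s = (f, lower s, upper s, g)" "(f, lower s, upper s, g) \<in> I"
    "f \<in> hom K (Dom K f) (Cod K f)" "g \<in> hom K (Dom K g) (Cod K g)"
    "lower s \<in> hom K (Dom K f) (Dom K g)" "upper s \<in> hom K (Cod K f) (Cod K g)"
    "upper s \<cdot> f = g \<cdot> lower s"
proof -
  show s: "s = (f, lower s, upper s, g)" and i: "(f, lower s, upper s, g) \<in> I"
    using assms hom_E[of s f g] by auto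
  show "f \<in> hom K (Dom K f) (Cod K f)" "g \<in> hom K (Dom K g) (Cod K g)"
    "lower s \<in> hom K (Dom K f) (Dom K g)" "upper s \<in> hom K (Cod K f) (Cod K g)"
    "upper s \<cdot> f = g \<cdot> lower s" by (rule indepD[OF notion i])+
qed

lemma lower_Comp: "s \<in> hom E f g \<Longrightarrow> t \<in> hom E g k \<Longrightarrow> lower (t \<cdot>\<^bsub>E\<^esub> s) = lower t \<cdot> lower s"
  by (metis Comp_E hom_ED(1) lower_simp)

lemma upper_Comp: "s \<in> hom E f g \<Longrightarrow> t \<in> hom E g k \<Longrightarrow> upper (t \<cdot>\<^bsub>E\<^esub> s) = upper t \<cdot> upper s"
  by (metis Comp_E hom_ED(1) upper_simp)

section \<open>The coreflective embedding of \<open>K\<close> into \<open>E\<close>\<close>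

text \<open>In any independent completion of the span \<open>(id, h)\<close> the top edge is forced
  to be \<open>cd \<cdot> h\<close>, so the completion extends the trivial square
  \<open>(id, h, h, id)\<close> along \<open>cd\<close>. Hence the trivial square is independent,
  and so are its extensions along \<open>g\<close>.\<close>

lemma Id_indep:
  assumes h: "h \<in> hom K M X" and g: "g \<in> hom K X Y"
  shows "(Id K M, h, g \<cdot> h, g) \<in> I"
proof -
  have M: "Id K M \<in> hom K M M" using Id_in_hom hom_Obj(1)[OF h] by blast
  have X: "Id K X \<in> hom K X X" using Id_in_hom hom_Obj(2)[OF h] by blast
  obtain bd cd where e: "(Id K M, h, bd, cd) \<in> I"
    using existence homD[OF M] homD[OF h] unfolding has_existence_def by metis
  have cd: "cd \<in> hom K X (Cod K cd)" and bd: "bd \<in> hom K M (Cod K cd)" and eq: "bd \<cdot> Id K M = cd \<cdot> h"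
    using indepD[OF notion e] homD[OF M] homD[OF h] by (auto simp: hom_def)
  have "(Id K M, h, cd \<cdot> h, cd \<cdot> Id K X) \<in> I"
    using e eq Comp_Id[OF bd] Comp_Id[OF cd] by simp
  then have "(Id K M, h, h, Id K X) \<in> I"
  proof (rule indep_restrict[OF notion])
    show "(Id K M, h, h, Id K X) \<in> comm_squares K"
      by (rule comm_squaresI[OF M h h X]) (simp add: Comp_Id[OF h] Id_Comp[OF h])
    show "cd \<in> hom K (Cod K (Id K X)) (Cod K cd)" using cd homD[OF X] by simp
  qed
  from indep_extend[OF notion this, of g Y] show ?thesis
    using g homD[OF X] Comp_Id[OF g] by simp
qed

text \<open>With an identity on the left, commutativity forces the upper edge. Together with
  \<open>Id_indep\<close> this identifies the arrows \<open>Id K M\<close> -> \<open>g\<close> of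
  \<open>E\<close> with the arrows \<open>M\<close> -> \<open>Dom K g\<close> of \<open>K\<close>,
  which is the adjunction behind the embedding.\<close>

lemma hom_Id_eq:
  assumes "M \<in> Obj K" "s \<in> hom E (Id K M) g"
  shows "s = (Id K M, lower s, g \<cdot> lower s, g)" "lower s \<in> hom K M (Dom K g)"
proof -
  have M: "Id K M \<in> hom K M M" using Id_in_hom assms(1) by blast
  note s = hom_ED[OF assms(2)]
  show "lower s \<in> hom K M (Dom K g)" using s(5) homD[OF M] by simp
  have "upper s \<in> hom K M (Cod K g)" using s(6) homD[OF M] by simp
  then have "upper s = g \<cdot> lower s" using s(7) Comp_Id[of "upper s"] by simp
  then show "s = (Id K M, lower s, g \<cdot> lower s, g)" using s(1) by simp
qed

text \<open>The action on arrows of the full embedding of \<open>K\<close> into \<open>E\<close>; on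
  objects it is \<open>Id K\<close>.\<close>

definition emb :: "'m \<Rightarrow> 'm square" where
  "emb h = (Id K (Dom K h), h, h, Id K (Cod K h))"

lemma emb_eq: "h \<in> hom K X Y \<Longrightarrow> emb h = (Id K X, h, h, Id K Y)"
  by (simp add: emb_def hom_def)

lemma emb_in_hom: "h \<in> hom K X Y \<Longrightarrow> emb h \<in> hom E (Id K X) (Id K Y)"
  using Id_indep[of h X Y "Id K Y" Y] Id_in_hom[of Y] hom_Obj[of h X Y] Id_Comp[of h X Y] emb_eq[of h X Y]
  by (auto intro: hom_E_I)

lemma emb_Comp: "f \<in> hom K X Y \<Longrightarrow> g \<in> hom K Y Z \<Longrightarrow> emb (g \<cdot> f) = emb g \<cdot>\<^bsub>E\<^esub> emb f"
  using emb_eq[of f X Y] emb_eq[of g Y Z] emb_eq[of "g \<cdot> f" X Z] Comp_in_hom[of f X Y g Z] by simp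

lemma hom_Id_Id:
  assumes "M \<in> Obj K" "N \<in> Obj K" "s \<in> hom E (Id K M) (Id K N)"
  shows "s = emb (lower s)" "lower s \<in> hom K M N"
proof -
  show l: "lower s \<in> hom K M N" using hom_Id_eq(2)[OF assms(1,3)] homD[OF Id_in_hom[OF assms(2)]] by simp
  show "s = emb (lower s)" using hom_Id_eq(1)[OF assms(1,3)] emb_eq[OF l] Id_Comp[OF l] by simp
qed

lemma emb_Id: "X \<in> Obj K \<Longrightarrow> emb (Id K X) = Id E (Id K X)"
  using Id_in_hom[of X] by (simp add: emb_def Id_E homD)

lemma lower_emb [simp]: "lower (emb h) = h" by (simp add: emb_def)

lemma emb_diagram:
  assumes "diagram K r D d"
  shows "diagram E r (\<lambda>i. Id K (D i)) (\<lambda>i j. emb (d i j))"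
  unfolding diagram_def
proof (intro conjI ballI allI impI)
  have D: "D i \<in> Obj K" if "i \<in> Field r" for i using assms that by (simp add: diagram_def)
  show "Id K (D i) \<in> Obj E" if "i \<in> Field r" for i using Id_in_hom[OF D[OF that]] by (simp add: homD)
  show "emb (d i j) \<in> hom E (Id K (D i)) (Id K (D j))" if "(i, j) \<in> r" for i j
    by (rule emb_in_hom[OF diagram_homD[OF assms that]])
  show "emb (d i i) = Id E (Id K (D i))" if "i \<in> Field r" for i
    using assms that emb_Id[OF D[OF that]] by (simp add: diagram_def)
  show "emb (d i k) = emb (d j k) \<cdot>\<^bsub>E\<^esub> emb (d i j)" if "(i, j) \<in> r" "(j, k) \<in> r" for i j k
    using emb_Comp[OF diagram_homD[OF assms that(1)] diagram_homD[OF assms that(2)]] diagram_comp[OF assms that] by simp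
qed

lemma emb_cocone:
  assumes "diagram K r D d" "cocone K r D d L c"
  shows "cocone E r (\<lambda>i. Id K (D i)) (\<lambda>i j. emb (d i j)) (Id K L) (\<lambda>i. emb (c i))"
  unfolding cocone_def
proof (intro conjI ballI allI impI)
  have "L \<in> Obj K" using assms(2) by (simp add: cocone_def)
  then show "Id K L \<in> Obj E" using homD(1)[OF Id_in_hom] by simp
  show "emb (c i) \<in> hom E (Id K (D i)) (Id K L)" if "i \<in> Field r" for i
    by (rule emb_in_hom[OF cocone_homD[OF assms(2) that]])
  show "emb (c j) \<cdot>\<^bsub>E\<^esub> emb (d i j) = emb (c i)" if ij: "(i, j) \<in> r" for i j
  proof -
    have "j \<in> Field r" using ij by (auto simp: Field_def)
    from emb_Comp[OF diagram_homD[OF assms(1) ij] cocone_homD[OF assms(2) this]] show ?thesis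
      using cocone_comp[OF assms(2) ij] by simp
  qed
qed

text \<open>A left adjoint preserves colimits: a cocone on the embedded diagram with vertex
  \<open>g\<close> is the same as a cocone in \<open>K\<close> with vertex
  \<open>Dom K g\<close>.\<close>

lemma emb_colimit:
  assumes dg: "diagram K r D d" and col: "colimit K r D d L c"
  shows "colimit E r (\<lambda>i. Id K (D i)) (\<lambda>i j. emb (d i j)) (Id K L) (\<lambda>i. emb (c i))"
  unfolding colimit_def
proof (intro conjI allI impI)
  note c = colimit_cocone[OF col]
  show "cocone E r (\<lambda>i. Id K (D i)) (\<lambda>i j. emb (d i j)) (Id K L) (\<lambda>i. emb (c i))"
    by (rule emb_cocone[OF dg c])
  have D: "D i \<in> Obj K" if "i \<in> Field r" for i using dg that by (simp add: diagram_def)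
  have L: "L \<in> Obj K" using c by (simp add: cocone_def)
  fix g b assume b: "cocone E r (\<lambda>i. Id K (D i)) (\<lambda>i j. emb (d i j)) g b"
  have gA: "g \<in> Arr K" using b by (simp add: cocone_def)
  note g = homI[OF gA]
  have bi: "b i = (Id K (D i), lower (b i), g \<cdot> lower (b i), g)" "lower (b i) \<in> hom K (D i) (Dom K g)"
    if "i \<in> Field r" for i using hom_Id_eq[OF D[OF that] cocone_homD[OF b that]] .
  have "cocone K r D d (Dom K g) (\<lambda>i. lower (b i))"
    unfolding cocone_def
  proof (intro conjI ballI allI impI)
    show "Dom K g \<in> Obj K" using Dom_in_Obj gA by blast
    show "lower (b i) \<in> hom K (D i) (Dom K g)" if "i \<in> Field r" for i using bi[OF that] by blast
    show "lower (b j) \<cdot> d i j = lower (b i)" if ij: "(i, j) \<in> r" for i j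
    proof -
      have j: "j \<in> Field r" using ij by (auto simp: Field_def)
      show ?thesis using cocone_comp[OF b ij] lower_Comp[OF emb_in_hom[OF diagram_homD[OF dg ij]] cocone_homD[OF b j]]
        by simp
    qed
  qed
  then obtain h where h: "h \<in> hom K L (Dom K g)" "\<And>i. i \<in> Field r \<Longrightarrow> h \<cdot> c i = lower (b i)"
    using colimit_factor[OF col] by blast
  show "\<exists>!k. k \<in> hom E (Id K L) g \<and> (\<forall>i\<in>Field r. k \<cdot>\<^bsub>E\<^esub> emb (c i) = b i)"
  proof (rule ex1I[of _ "(Id K L, h, g \<cdot> h, g)"], intro conjI ballI)
    show "(Id K L, h, g \<cdot> h, g) \<in> hom E (Id K L) g" using hom_E_I[OF Id_indep[OF h(1) g]] .
    fix i assume i: "i \<in> Field r"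
    show "(Id K L, h, g \<cdot> h, g) \<cdot>\<^bsub>E\<^esub> emb (c i) = b i"
      using emb_eq[OF cocone_homD[OF c i]] Comp_assoc[OF cocone_homD[OF c i] h(1) g] h(2)[OF i] bi(1)[OF i]
      by simp
  next
    fix k assume k: "k \<in> hom E (Id K L) g \<and> (\<forall>i\<in>Field r. k \<cdot>\<^bsub>E\<^esub> emb (c i) = b i)"
    then have kE: "k \<in> hom E (Id K L) g" by blast
    note kk = hom_Id_eq[OF L kE]
    have "lower k = h"
    proof (rule colimit_eqI[OF col dg kk(2) h(1)])
      fix i assume i: "i \<in> Field r"
      show "lower k \<cdot> c i = h \<cdot> c i"
        using lower_Comp[OF emb_in_hom[OF cocone_homD[OF c i]] kE] k i h(2)[OF i] by simp
    qed
    then show "k = (Id K L, h, g \<cdot> h, g)" using kk(1) by simp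
  qed
qed

text \<open>Domains are right adjoint to the embedding \<^term>\<open>emb\<close>; as for every coreflective full
  subcategory, the domain of a colimit in \<^term>\<open>E\<close> of embedded objects is a colimit in \<^term>\<open>K\<close>.\<close>

lemma colimit_exists:
  assumes ex: "\<And>F s. diagram E r F s \<Longrightarrow> \<exists>f t. colimit E r F s f t" and dg: "diagram K r D d"
  shows "\<exists>L c. colimit K r D d L c"
proof -
  let ?F = "\<lambda>i. Id K (D i)" and ?s = "\<lambda>i j. emb (d i j)"
  note dE = emb_diagram[OF dg]
  obtain g t where col: "colimit E r ?F ?s g t" using ex[OF dE] by blast
  note t = colimit_cocone[OF col]
  have D: "D i \<in> Obj K" if "i \<in> Field r" for i using dg that by (simp add: diagram_def)
  have gA: "g \<in> Arr K" using t by (simp add: cocone_def)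
  define X where "X = Dom K g"
  have g: "g \<in> hom K X (Cod K g)" using homI[OF gA] X_def by simp
  have X: "X \<in> Obj K" using Dom_in_Obj gA X_def by blast
  define x where "x i = lower (t i)" for i
  have ti: "t i = (Id K (D i), x i, g \<cdot> x i, g)" "x i \<in> hom K (D i) X" if "i \<in> Field r" for i
    unfolding x_def X_def using hom_Id_eq[OF D[OF that] cocone_homD[OF t that]] .
  have coc: "cocone K r D d X x"
    unfolding cocone_def
  proof (intro conjI ballI allI impI)
    show "X \<in> Obj K" by (rule X)
    show "x i \<in> hom K (D i) X" if "i \<in> Field r" for i using ti[OF that] by blast
    show "x j \<cdot> d i j = x i" if ij: "(i, j) \<in> r" for i j
    proof -
      have j: "j \<in> Field r" using ij by (auto simp: Field_def)
      show ?thesis unfolding x_def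
        using cocone_comp[OF t ij] lower_Comp[OF emb_in_hom[OF diagram_homD[OF dg ij]] cocone_homD[OF t j]]
        by simp
    qed
  qed
  obtain \<tau> where \<tau>: "\<tau> \<in> hom E g (Id K X)" "\<And>i. i \<in> Field r \<Longrightarrow> \<tau> \<cdot>\<^bsub>E\<^esub> t i = emb (x i)"
    using colimit_factor[OF col emb_cocone[OF dg coc]] by blast
  have IX: "Id K X \<in> hom K X X" using Id_in_hom X by blast
  \<comment> \<open>This square is the counit of the coreflection at \<open>g\<close>, and
    \<open>\<tau>\<close> turns out to be a section of it. As its lower edge is an identity, so is
    that of \<open>\<tau>\<close>.\<close>
  have \<epsilon>: "(Id K X, Id K X, g \<cdot> Id K X, g) \<in> hom E (Id K X) g" using hom_E_I[OF Id_indep[OF IX g]] .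
  have "(Id K X, Id K X, g \<cdot> Id K X, g) \<cdot>\<^bsub>E\<^esub> \<tau> = Id E g"
  proof (rule E.colimit_eqI[OF col dE E.Comp_in_hom[OF \<tau>(1) \<epsilon>]])
    show "Id E g \<in> hom E g g" using E.Id_in_hom gA by simp
    fix i assume i: "i \<in> Field r"
    show "(Id K X, Id K X, g \<cdot> Id K X, g) \<cdot>\<^bsub>E\<^esub> \<tau> \<cdot>\<^bsub>E\<^esub> t i = Id E g \<cdot>\<^bsub>E\<^esub> t i"
      using E.Comp_assoc[OF cocone_homD[OF t i] \<tau>(1) \<epsilon>] \<tau>(2)[OF i] emb_eq[OF ti(2)[OF i]] ti(1)[OF i]
        Id_Comp[OF ti(2)[OF i]] Comp_Id[OF g] E.Id_Comp[OF cocone_homD[OF t i]] by simp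
  qed
  then have "Id K X \<cdot> lower \<tau> = Id K X"
    using lower_Comp[OF \<tau>(1) \<epsilon>] by (simp add: Id_E X_def)
  then have l\<tau>: "lower \<tau> = Id K X"
    using hom_ED(5)[OF \<tau>(1)] homD[OF IX] Id_Comp[of "lower \<tau>" X X] by (simp add: X_def)
  have "colimit K r D d X x"
    unfolding colimit_def
  proof (intro conjI allI impI)
    show "cocone K r D d X x" by (rule coc)
    fix Z b assume b: "cocone K r D d Z b"
    have Z: "Z \<in> Obj K" using b by (simp add: cocone_def)
    have IZ: "Id K Z \<in> hom K Z Z" using Id_in_hom Z by blast
    obtain k where k: "k \<in> hom E g (Id K Z)" "\<And>i. i \<in> Field r \<Longrightarrow> k \<cdot>\<^bsub>E\<^esub> t i = emb (b i)"
      using colimit_factor[OF col emb_cocone[OF dg b]] by blast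
    show "\<exists>!h. h \<in> hom K X Z \<and> (\<forall>i\<in>Field r. h \<cdot> x i = b i)"
    proof (rule ex1I[of _ "lower k"], intro conjI ballI)
      show "lower k \<in> hom K X Z" using hom_ED(5)[OF k(1)] homD[OF IZ] by (simp add: X_def)
      show "lower k \<cdot> x i = b i" if "i \<in> Field r" for i
        using lower_Comp[OF cocone_homD[OF t that] k(1)] k(2)[OF that] by (simp add: x_def)
    next
      fix h assume h: "h \<in> hom K X Z \<and> (\<forall>i\<in>Field r. h \<cdot> x i = b i)"
      then have hX: "h \<in> hom K X Z" by blast
      have "emb h \<cdot>\<^bsub>E\<^esub> \<tau> = k"
      proof (rule E.colimit_eqI[OF col dE E.Comp_in_hom[OF \<tau>(1) emb_in_hom[OF hX]] k(1)])
        fix i assume i: "i \<in> Field r"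
        show "emb h \<cdot>\<^bsub>E\<^esub> \<tau> \<cdot>\<^bsub>E\<^esub> t i = k \<cdot>\<^bsub>E\<^esub> t i"
          using E.Comp_assoc[OF cocone_homD[OF t i] \<tau>(1) emb_in_hom[OF hX]] \<tau>(2)[OF i] k(2)[OF i]
            emb_Comp[OF ti(2)[OF i] hX] h i by simp
      qed
      then show "h = lower k"
        using lower_Comp[OF \<tau>(1) emb_in_hom[OF hX]] l\<tau> Comp_Id[OF hX] by simp
    qed
  qed
  then show ?thesis by blast
qed

section \<open>Colimits in \<open>E\<close> are computed on domains and codomains\<close>

lemma lower_diagram:
  assumes "diagram E r F s"
  shows "diagram K r (\<lambda>i. Dom K (F i)) (\<lambda>i j. lower (s i j))"
  unfolding diagram_def
proof (intro conjI ballI allI impI)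
  have F: "F i \<in> Arr K" if "i \<in> Field r" for i using assms that by (simp add: diagram_def)
  show "Dom K (F i) \<in> Obj K" if "i \<in> Field r" for i using Dom_in_Obj F that by blast
  show "lower (s i j) \<in> hom K (Dom K (F i)) (Dom K (F j))" if "(i, j) \<in> r" for i j
    using hom_ED(5)[OF diagram_homD[OF assms that]] .
  show "lower (s i i) = Id K (Dom K (F i))" if "i \<in> Field r" for i
    using assms that by (simp add: diagram_def Id_E)
  show "lower (s i k) = lower (s j k) \<cdot> lower (s i j)" if "(i, j) \<in> r" "(j, k) \<in> r" for i j k
    using lower_Comp[OF diagram_homD[OF assms that(1)] diagram_homD[OF assms that(2)]] diagram_comp[OF assms that] by simp
qed

lemma upper_diagram:
  assumes "diagram E r F s"
  shows "diagram K r (\<lambda>i. Cod K (F i)) (\<lambda>i j. upper (s i j))"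
  unfolding diagram_def
proof (intro conjI ballI allI impI)
  have F: "F i \<in> Arr K" if "i \<in> Field r" for i using assms that by (simp add: diagram_def)
  show "Cod K (F i) \<in> Obj K" if "i \<in> Field r" for i using Cod_in_Obj F that by blast
  show "upper (s i j) \<in> hom K (Cod K (F i)) (Cod K (F j))" if "(i, j) \<in> r" for i j
    using hom_ED(6)[OF diagram_homD[OF assms that]] .
  show "upper (s i i) = Id K (Cod K (F i))" if "i \<in> Field r" for i
    using assms that by (simp add: diagram_def Id_E)
  show "upper (s i k) = upper (s j k) \<cdot> upper (s i j)" if "(i, j) \<in> r" "(j, k) \<in> r" for i j k
    using upper_Comp[OF diagram_homD[OF assms that(1)] diagram_homD[OF assms that(2)]] diagram_comp[OF assms that] by simp
qed

lemma lower_cocone: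
  assumes "diagram E r F s" "cocone E r F s f t"
  shows "cocone K r (\<lambda>i. Dom K (F i)) (\<lambda>i j. lower (s i j)) (Dom K f) (\<lambda>i. lower (t i))"
  unfolding cocone_def
proof (intro conjI ballI allI impI)
  show "Dom K f \<in> Obj K" using assms(2) Dom_in_Obj by (simp add: cocone_def)
  show "lower (t i) \<in> hom K (Dom K (F i)) (Dom K f)" if "i \<in> Field r" for i
    using hom_ED(5)[OF cocone_homD[OF assms(2) that]] .
  show "lower (t j) \<cdot> lower (s i j) = lower (t i)" if ij: "(i, j) \<in> r" for i j
  proof -
    have "j \<in> Field r" using ij by (auto simp: Field_def)
    from lower_Comp[OF diagram_homD[OF assms(1) ij] cocone_homD[OF assms(2) this]] show ?thesis
      using cocone_comp[OF assms(2) ij] by simp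
  qed
qed

lemma upper_cocone:
  assumes "diagram E r F s" "cocone E r F s f t"
  shows "cocone K r (\<lambda>i. Cod K (F i)) (\<lambda>i j. upper (s i j)) (Cod K f) (\<lambda>i. upper (t i))"
  unfolding cocone_def
proof (intro conjI ballI allI impI)
  show "Cod K f \<in> Obj K" using assms(2) Cod_in_Obj by (simp add: cocone_def)
  show "upper (t i) \<in> hom K (Cod K (F i)) (Cod K f)" if "i \<in> Field r" for i
    using hom_ED(6)[OF cocone_homD[OF assms(2) that]] .
  show "upper (t j) \<cdot> upper (s i j) = upper (t i)" if ij: "(i, j) \<in> r" for i j
  proof -
    have "j \<in> Field r" using ij by (auto simp: Field_def)
    from upper_Comp[OF diagram_homD[OF assms(1) ij] cocone_homD[OF assms(2) this]] show ?thesis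
      using cocone_comp[OF assms(2) ij] by simp
  qed
qed

text \<open>Compare a colimit \<open>f\<close> in \<^term>\<open>E\<close> with the arrow \<open>\<phi>\<close> between the colimits in \<^term>\<open>K\<close> of the
  domains and of the codomains: there are \<open>(a, b) : f \<rightarrow> \<phi>\<close> in \<^term>\<open>E\<close> and \<open>(h, q) : \<phi> \<rightarrow> f\<close> which is only a
  commutative square. The legs into \<open>f\<close> cannot tell apart the independent squares
  \<open>(id, q b)\<close> and \<open>(h a, q b)\<close> from \<open>f\<close> to \<open>q b f\<close>, hence \<open>h a = id\<close>; then \<open>q b f = f\<close>, and they
  cannot tell apart \<open>(id, q b)\<close> and the identity of \<open>f\<close>.\<close>

lemma colimit_pointwise:
  assumes ex: "\<And>F s. diagram E r F s \<Longrightarrow> \<exists>f t. colimit E r F s f t"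
    and dg: "diagram E r F s" and col: "colimit E r F s f t"
  shows "colimit K r (\<lambda>i. Dom K (F i)) (\<lambda>i j. lower (s i j)) (Dom K f) (\<lambda>i. lower (t i))"
    and "colimit K r (\<lambda>i. Cod K (F i)) (\<lambda>i j. upper (s i j)) (Cod K f) (\<lambda>i. upper (t i))"
proof -
  note t = colimit_cocone[OF col]
  note dgl = lower_diagram[OF dg] and dgu = upper_diagram[OF dg]
  note cl = lower_cocone[OF dg t] and cu = upper_cocone[OF dg t]
  define X where "X = Dom K f"
  define Y where "Y = Cod K f"
  define x where "x i = lower (t i)" for i
  define y where "y i = upper (t i)" for i
  have fA: "f \<in> Arr K" using t by (simp add: cocone_def)
  have f: "f \<in> hom K X Y" using homI[OF fA] by (simp add: X_def Y_def)
  have IX: "Id K X \<in> hom K X X" and IY: "Id K Y \<in> hom K Y Y" using hom_Obj[OF f] Id_in_hom by auto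
  have tI: "t i = (F i, x i, y i, f)" "(F i, x i, y i, f) \<in> I" "F i \<in> hom K (Dom K (F i)) (Cod K (F i))"
    "x i \<in> hom K (Dom K (F i)) X" "y i \<in> hom K (Cod K (F i)) Y" "y i \<cdot> F i = f \<cdot> x i" if "i \<in> Field r" for i
    using hom_ED[OF cocone_homD[OF t that]] by (simp_all add: x_def y_def X_def Y_def)
  obtain X' x' where colX: "colimit K r (\<lambda>i. Dom K (F i)) (\<lambda>i j. lower (s i j)) X' x'"
    using colimit_exists[OF ex dgl] by blast
  obtain Y' y' where colY: "colimit K r (\<lambda>i. Cod K (F i)) (\<lambda>i j. upper (s i j)) Y' y'"
    using colimit_exists[OF ex dgu] by blast
  note cX = colimit_cocone[OF colX] and cY = colimit_cocone[OF colY]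
  obtain h where h: "h \<in> hom K X' X" "\<And>i. i \<in> Field r \<Longrightarrow> h \<cdot> x' i = x i"
    using colimit_factor[OF colX cl] unfolding x_def X_def by blast
  obtain q where q: "q \<in> hom K Y' Y" "\<And>i. i \<in> Field r \<Longrightarrow> q \<cdot> y' i = y i"
    using colimit_factor[OF colY cu] unfolding y_def Y_def by blast
  have x': "x' i \<in> hom K (Dom K (F i)) X'" if "i \<in> Field r" for i using cocone_homD[OF cX that] .
  have y': "y' i \<in> hom K (Cod K (F i)) Y'" if "i \<in> Field r" for i using cocone_homD[OF cY that] .
  have FI: "i \<in> Field r" "j \<in> Field r" if "(i, j) \<in> r" for i j using that by (auto simp: Field_def)
  have "cocone K r (\<lambda>i. Dom K (F i)) (\<lambda>i j. lower (s i j)) Y' (\<lambda>i. y' i \<cdot> F i)"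
    unfolding cocone_def
  proof (intro conjI ballI allI impI)
    show "Y' \<in> Obj K" using hom_Obj[OF q(1)] by blast
    show "y' i \<cdot> F i \<in> hom K (Dom K (F i)) Y'" if "i \<in> Field r" for i
      using Comp_in_hom[OF tI(3)[OF that] y'[OF that]] .
    fix i j assume ij: "(i, j) \<in> r"
    note sij = hom_ED[OF diagram_homD[OF dg ij]]
    show "y' j \<cdot> F j \<cdot> lower (s i j) = y' i \<cdot> F i"
      using Comp_assoc[OF sij(5) sij(4) y'[OF FI(2)[OF ij]]] sij(7) Comp_assoc[OF sij(3) sij(6) y'[OF FI(2)[OF ij]]]
        cocone_comp[OF cY ij] by simp
  qed
  then obtain \<phi> where \<phi>: "\<phi> \<in> hom K X' Y'" "\<And>i. i \<in> Field r \<Longrightarrow> \<phi> \<cdot> x' i = y' i \<cdot> F i"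
    using colimit_factor[OF colX] by blast
  have IX': "Id K X' \<in> hom K X' X'" and IY': "Id K Y' \<in> hom K Y' Y'" using hom_Obj[OF \<phi>(1)] Id_in_hom by auto
  have q\<phi>: "q \<cdot> \<phi> = f \<cdot> h"
  proof (rule colimit_eqI[OF colX dgl Comp_in_hom[OF \<phi>(1) q(1)] Comp_in_hom[OF h(1) f]])
    fix i assume i: "i \<in> Field r"
    show "q \<cdot> \<phi> \<cdot> x' i = f \<cdot> h \<cdot> x' i"
      using Comp_assoc[OF x'[OF i] \<phi>(1) q(1)] \<phi>(2)[OF i] Comp_assoc[OF tI(3)[OF i] y'[OF i] q(1)] q(2)[OF i]
        tI(6)[OF i] Comp_assoc[OF x'[OF i] h(1) f] h(2)[OF i] by simp
  qed
  \<comment> \<open>As \<open>x i\<close> factors as \<open>h \<cdot> x' i\<close>, monotonicity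
    moves \<open>h\<close> from the bottom to the right edge. The resulting square is the desired
    one extended along \<open>q\<close>, and independence descends.\<close>
  have legs: "(F i, x' i, y' i, \<phi>) \<in> I" if i: "i \<in> Field r" for i
  proof (rule indep_restrict[OF notion])
    have "(F i, x' i, y i, f \<cdot> h) \<in> I"
      by (rule monotonic[OF _ x'[OF i] h(1) f]) (simp add: h(2)[OF i] tI(2)[OF i])
    then show "(F i, x' i, q \<cdot> y' i, q \<cdot> \<phi>) \<in> I" using q(2)[OF i] q\<phi> by simp
    show "(F i, x' i, y' i, \<phi>) \<in> comm_squares K"
      by (rule comm_squaresI[OF tI(3)[OF i] x'[OF i] y'[OF i] \<phi>(1)]) (simp add: \<phi>(2)[OF i])
    show "q \<in> hom K (Cod K \<phi>) Y" using q(1) homD[OF \<phi>(1)] by simp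
  qed
  have "cocone E r F s \<phi> (\<lambda>i. (F i, x' i, y' i, \<phi>))"
    unfolding cocone_def
  proof (intro conjI ballI allI impI)
    show "\<phi> \<in> Obj E" using homD[OF \<phi>(1)] by simp
    show "(F i, x' i, y' i, \<phi>) \<in> hom E (F i) \<phi>" if "i \<in> Field r" for i using hom_E_I[OF legs[OF that]] .
    fix i j assume ij: "(i, j) \<in> r"
    note sij = hom_ED[OF diagram_homD[OF dg ij]]
    show "(F j, x' j, y' j, \<phi>) \<cdot>\<^bsub>E\<^esub> s i j = (F i, x' i, y' i, \<phi>)"
      using sij(1) Comp_E[of "F j" "x' j" "y' j" \<phi> "F i" "lower (s i j)" "upper (s i j)" "F j"]
        cocone_comp[OF cX ij] cocone_comp[OF cY ij] by simp
  qed
  then obtain \<sigma> where \<sigma>: "\<sigma> \<in> hom E f \<phi>" "\<And>i. i \<in> Field r \<Longrightarrow> \<sigma> \<cdot>\<^bsub>E\<^esub> t i = (F i, x' i, y' i, \<phi>)"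
    using colimit_factor[OF col] by blast
  define a where "a = lower \<sigma>"
  define b where "b = upper \<sigma>"
  have \<sigma>_eq: "\<sigma> = (f, a, b, \<phi>)" unfolding a_def b_def by (rule hom_ED(1)[OF \<sigma>(1)])
  have a: "a \<in> hom K X X'" and b: "b \<in> hom K Y Y'" and ab: "b \<cdot> f = \<phi> \<cdot> a"
    using hom_ED[OF \<sigma>(1)] homD[OF \<phi>(1)] by (simp_all add: a_def b_def X_def Y_def)
  have ax: "a \<cdot> x i = x' i" and bY: "b \<cdot> y i = y' i" if "i \<in> Field r" for i
    using \<sigma>(2)[OF that] tI(1)[OF that] \<sigma>_eq by simp_all
  have ah: "a \<cdot> h = Id K X'"
  proof (rule colimit_eqI[OF colX dgl Comp_in_hom[OF h(1) a] IX'])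
    fix i assume i: "i \<in> Field r"
    show "a \<cdot> h \<cdot> x' i = Id K X' \<cdot> x' i"
      using Comp_assoc[OF x'[OF i] h(1) a] h(2)[OF i] ax[OF i] Id_Comp[OF x'[OF i]] by simp
  qed
  have qb: "q \<cdot> b \<in> hom K Y Y" using Comp_in_hom[OF b q(1)] .
  define f' where "f' = q \<cdot> b \<cdot> f"
  have f'A: "f' \<in> hom K X Y" unfolding f'_def using Comp_in_hom[OF f qb] .
  have f'1: "f' = q \<cdot> \<phi> \<cdot> a"
    unfolding f'_def using Comp_assoc[OF f b q(1)] ab Comp_assoc[OF a \<phi>(1) q(1)] by simp
  have Idf: "(f, Id K X, Id K Y, f) \<in> I"
    using hom_ED(2)[OF E.Id_in_hom[of f]] fA by (simp add: Id_E X_def Y_def)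
  have c1: "(f, Id K X, q \<cdot> b, f') \<in> I"
    using indep_extend[OF notion Idf, of "q \<cdot> b" Y] qb Comp_Id[OF qb] homD[OF f] by (simp add: f'_def)
  \<comment> \<open>The square \<open>(h, q)\<close> becomes independent once its target is
    \<open>f'\<close> instead of \<open>f\<close>: extend the identity square of
    \<open>\<phi>\<close> along \<open>q\<close>, write its bottom as \<open>a \<cdot> h\<close>,
    and split off \<open>a\<close> by monotonicity.\<close>
  have "(\<phi>, Id K X', Id K Y', \<phi>) \<in> I"
    using hom_ED(2)[OF E.Id_in_hom[of \<phi>]] homD[OF \<phi>(1)] by (simp add: Id_E)
  from indep_extend[OF notion this, of q Y] have "(\<phi>, a \<cdot> h, q, q \<cdot> \<phi>) \<in> I"
    using q(1) Comp_Id[OF q(1)] homD[OF \<phi>(1)] ah by simp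
  from monotonic[OF this h(1) a Comp_in_hom[OF \<phi>(1) q(1)]] have c2: "(\<phi>, h, q, f') \<in> I"
    using f'1 by simp
  have c3: "(f, h \<cdot> a, q \<cdot> b, f') \<in> hom E f f'"
    using E.Comp_in_hom[OF \<sigma>(1) hom_E_I[OF c2]] \<sigma>_eq by simp
  have "(f, Id K X, q \<cdot> b, f') = (f, h \<cdot> a, q \<cdot> b, f')"
  proof (rule E.colimit_eqI[OF col dg hom_E_I[OF c1] c3])
    fix i assume i: "i \<in> Field r"
    show "(f, Id K X, q \<cdot> b, f') \<cdot>\<^bsub>E\<^esub> t i = (f, h \<cdot> a, q \<cdot> b, f') \<cdot>\<^bsub>E\<^esub> t i"
      using tI(1)[OF i] Id_Comp[OF tI(4)[OF i]] Comp_assoc[OF tI(4)[OF i] a h(1)] ax[OF i] h(2)[OF i] by simp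
  qed
  then have ha: "h \<cdot> a = Id K X" by simp
  have "f' = f" using f'1 q\<phi> Comp_assoc[OF a h(1) f] ha Comp_Id[OF f] by simp
  then have c1': "(f, Id K X, q \<cdot> b, f) \<in> hom E f f" using c1 hom_E_I by simp
  have "(f, Id K X, q \<cdot> b, f) = (f, Id K X, Id K Y, f)"
  proof (rule E.colimit_eqI[OF col dg c1' hom_E_I[OF Idf]])
    fix i assume i: "i \<in> Field r"
    show "(f, Id K X, q \<cdot> b, f) \<cdot>\<^bsub>E\<^esub> t i = (f, Id K X, Id K Y, f) \<cdot>\<^bsub>E\<^esub> t i"
      using tI(1)[OF i] Id_Comp[OF tI(5)[OF i]] Comp_assoc[OF tI(5)[OF i] b q(1)] bY[OF i] q(2)[OF i] by simp
  qed
  then have qbI: "q \<cdot> b = Id K Y" by simp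
  show "colimit K r (\<lambda>i. Dom K (F i)) (\<lambda>i j. lower (s i j)) (Dom K f) (\<lambda>i. lower (t i))"
    by (rule colimit_iso[OF colX dgl cl, of h a]) (use h a ha ax in \<open>simp_all add: X_def x_def\<close>)
  show "colimit K r (\<lambda>i. Cod K (F i)) (\<lambda>i j. upper (s i j)) (Cod K f) (\<lambda>i. upper (t i))"
    by (rule colimit_iso[OF colY dgu cu, of q b]) (use q b qbI bY in \<open>simp_all add: Y_def y_def\<close>)
qed

end

section \<open>Cardinal arithmetic\<close>

lemma Cinfinite_Pow:
  assumes "infinite V"
  shows "Cinfinite |Pow V|"
  using assms by (simp add: cinfinite_def Field_card_of card_of_card_order_on finite_Pow_iff)

lemma card_of_Pow_ordIso_cexp: "|Pow A| =o ctwo ^c |A|"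
  using card_of_Pow_Func[of A] by (simp add: cexp_def ctwo_def Field_card_of)

text \<open>For infinite \<open>V\<close>, (2^V)^V = 2^(V x V) = 2^V. This makes
  \<open>|Pow V|\<close> a suitable size bound: a set of this size has no more than
  \<open>|Pow V|\<close> families indexed by \<open>V\<close>.\<close>

lemma card_of_Func_ordLeq_Pow:
  assumes V: "infinite V" and S: "|S| \<le>o |Pow V|"
  shows "|Func V S| \<le>o |Pow V|"
proof -
  have CV: "Cinfinite |V|" using V by (simp add: cinfinite_def Field_card_of card_of_card_order_on)
  have "|Func V S| =o |S| ^c |V|" by (simp add: cexp_def Field_card_of card_of_refl)
  also have "|S| ^c |V| \<le>o (ctwo ^c |V| ) ^c |V|"
    using cexp_mono1[OF ordLeq_ordIso_trans[OF S card_of_Pow_ordIso_cexp] card_of_Card_order] .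
  also have "(ctwo ^c |V| ) ^c |V| =o ctwo ^c |V|"
    by (rule cexp_cprod_ordLeq[OF Card_order_ctwo CV Cinfinite_Cnotzero[OF CV] ordLeq_refl]) (rule card_of_Card_order)
  also have "ctwo ^c |V| =o |Pow V|" using card_of_Pow_ordIso_cexp ordIso_symmetric by blast
  finally show ?thesis .
qed

section \<open>Bounds in regular cardinals and closure in directed posets\<close>

lemma Partial_order_Field_Restr:
  "Partial_order r \<Longrightarrow> J \<subseteq> Field r \<Longrightarrow> Field (Restr r J) = J"
  by (rule Refl_Field_Restr2) (simp_all add: partial_order_on_def preorder_on_def)

text \<open>A set of size below \<open>r\<close> is not cofinal, and in a total order an element
  witnessing this is an upper bound.\<close>

lemma regularCard_bounded:
  assumes r: "Card_order r" "regularCard r" and S: "S \<subseteq> Field r" "|S| <o r"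
  shows "\<exists>a \<in> Field r. \<forall>b \<in> S. (b, a) \<in> r"
proof -
  have "\<not> |S| =o r" using S(2) not_ordLess_ordIso by blast
  then have "\<not> cofinal S r" using r(2) S(1) unfolding regularCard_def by blast
  then obtain a where a: "a \<in> Field r" "\<forall>b \<in> S. a = b \<or> (a, b) \<notin> r" unfolding cofinal_def by blast
  have "(b, a) \<in> r" if "b \<in> S" for b
  proof -
    have w: "Well_order r" using r(1) card_order_on_well_order_on by blast
    then have "Total r" "Refl r" by (auto simp: order_on_defs)
    then show ?thesis using a that S(1) unfolding total_on_def refl_on_def by (metis subsetD)
  qed
  then show ?thesis using a(1) by blast
qed

text \<open>Close off in \<open>\<mu>\<close> stages, adding an upper bound for each
  \<open>V\<close>-indexed family of earlier elements that has one. Nonempty sets of size below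
  \<open>\<mu>\<close> are ranges of such families because \<open>\<mu> \<le>o |V|\<close>, and by
  regularity they lie in a single stage. No stage outgrows \<open>|Pow V|\<close>.\<close>

lemma directed_closure:
  fixes \<mu> r :: "'u rel" and V :: "'u set"
  assumes \<mu>: "Cinfinite \<mu>" "regularCard \<mu>" and V: "\<mu> \<le>o |V|"
    and r: "directed_poset \<mu> r" and J0: "J0 \<subseteq> Field r" "|J0| \<le>o |Pow V|"
  shows "\<exists>J. J0 \<subseteq> J \<and> J \<subseteq> Field r \<and> |J| \<le>o |Pow V| \<and> directed_poset \<mu> (Restr r J)"
proof -
  have V\<mu>: "cinfinite |V|" using cinfinite_mono[OF V] \<mu> by blast
  then have infV: "infinite V" by (simp add: cinfinite_def Field_card_of)
  note CP = Cinfinite_Pow[OF infV]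
  have W\<mu>: "Well_order \<mu>" using \<mu> card_order_on_well_order_on by blast
  have po: "Partial_order r" using r by (simp add: directed_poset_def)
  \<comment> \<open>\<open>u0\<close> bounds the empty set: it keeps the closure nonempty and is the
    fallback value for families without a bound.\<close>
  obtain u0 where u0: "u0 \<in> Field r"
  proof -
    have "|{}| <o \<mu>"
      by (rule Cfinite_ordLess_Cinfinite[OF _ \<mu>(1)]) (auto simp: cfinite_def Field_card_of card_of_card_order_on)
    then show thesis using r that unfolding directed_poset_def by blast
  qed
  \<comment> \<open>A total choice of bounds. A family indexed by \<open>V\<close> may have
    \<open>\<mu>\<close> or more values and no bound at all; then \<open>U g\<close> is just some
    element of the field.\<close>
  define U where "U g = (SOME u. u \<in> Field r \<and> ((\<exists>w \<in> Field r. \<forall>x \<in> g ` V. (x, w) \<in> r) \<longrightarrow> (\<forall>x \<in> g ` V. (x, u) \<in> r)))"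
    for g :: "'u \<Rightarrow> 'u"
  have U: "U g \<in> Field r" "(\<exists>w \<in> Field r. \<forall>x \<in> g ` V. (x, w) \<in> r) \<Longrightarrow> (\<forall>x \<in> g ` V. (x, U g) \<in> r)" for g
  proof -
    have "\<exists>u. u \<in> Field r \<and> ((\<exists>w \<in> Field r. \<forall>x \<in> g ` V. (x, w) \<in> r) \<longrightarrow> (\<forall>x \<in> g ` V. (x, u) \<in> r))"
      using u0 by blast
    from someI_ex[OF this] show "U g \<in> Field r"
      "(\<exists>w \<in> Field r. \<forall>x \<in> g ` V. (x, w) \<in> r) \<Longrightarrow> (\<forall>x \<in> g ` V. (x, U g) \<in> r)" unfolding U_def by blast+
  qed
  \<comment> \<open>The recursion equation for stage \<open>a\<close>. \<open>Func V\<close>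
    consists of functions that are \<open>undefined\<close> outside \<open>V\<close>, so its
    cardinality is a genuine power.\<close>
  define Q where "Q F a S \<longleftrightarrow> S = insert u0 J0 \<union> U ` Func V (\<Union>b \<in> underS \<mu> a. F b)" for F a S
  have wf: "wf (\<mu> - Relation.Id)" using W\<mu> by (simp add: well_order_on_def)
  have "\<exists>F. \<forall>a. Q F a (F a)"
  proof (rule dependent_wf_choice[OF wf])
    show "Q f a S = Q g a S" if "\<And>z. (z, a) \<in> \<mu> - Relation.Id \<Longrightarrow> f z = g z" for f g a S
    proof -
      have "(\<Union>b \<in> underS \<mu> a. f b) = (\<Union>b \<in> underS \<mu> a. g b)"
        using that by (intro SUP_cong) (auto simp: underS_def)
      then show ?thesis by (simp add: Q_def)
    qed
  qed (simp add: Q_def)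
  then obtain F where F: "F a = insert u0 J0 \<union> U ` Func V (\<Union>b \<in> underS \<mu> a. F b)" for a
    unfolding Q_def by blast
  have F_sub: "F a \<subseteq> Field r" for a unfolding F[of a] using u0 J0(1) U(1) by auto
  have F0: "u0 \<in> F a" "J0 \<subseteq> F a" for a unfolding F[of a] by auto
  have F_card: "|F a| \<le>o |Pow V|" for a
  proof (induction a rule: wf_induct_rule[OF wf])
    case (1 a)
    have "|underS \<mu> a| \<le>o |Field \<mu>|" by (rule card_of_mono1) (auto simp: underS_def Field_def)
    also have "|Field \<mu>| =o \<mu>" using card_of_Field_ordIso \<mu> by blast
    also note V
    also have "|V| \<le>o |Pow V|" using card_of_Pow ordLess_imp_ordLeq by blast
    finally have "|\<Union>b \<in> underS \<mu> a. F b| \<le>o |Pow V|"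
      using 1 by (intro UNION_Cinfinite_bound[OF _ _ CP]) (auto simp: underS_def)
    then have "|U ` Func V (\<Union>b \<in> underS \<mu> a. F b)| \<le>o |Pow V|"
      using ordLeq_transitive[OF card_of_image card_of_Func_ordLeq_Pow[OF infV]] by blast
    moreover have "|{u0}| \<le>o |Pow V|" by (rule finite_ordLeq_Cinfinite[OF _ CP]) simp
    ultimately have "|({u0} \<union> J0) \<union> U ` Func V (\<Union>b \<in> underS \<mu> a. F b)| \<le>o |Pow V|"
      using J0(2) CP by (intro Un_Cinfinite_bound)
    then show ?case unfolding F[of a] by simp
  qed
  have F_mono: "relChain \<mu> F"
    unfolding relChain_def
  proof (intro allI impI)
    fix a b assume ab: "(a, b) \<in> \<mu>"
    have "trans \<mu>" "antisym \<mu>" using W\<mu> by (auto simp: order_on_defs)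
    then have "underS \<mu> a \<subseteq> underS \<mu> b" using underS_incr ab by metis
    then have "(\<Union>c \<in> underS \<mu> a. F c) \<subseteq> (\<Union>c \<in> underS \<mu> b. F c)" by blast
    then have "Func V (\<Union>c \<in> underS \<mu> a. F c) \<subseteq> Func V (\<Union>c \<in> underS \<mu> b. F c)"
      unfolding Func_def by blast
    then show "F a \<subseteq> F b" unfolding F[of a] F[of b] by blast
  qed
  define J where "J = (\<Union>a \<in> Field \<mu>. F a)"
  have J_sub: "J \<subseteq> Field r" unfolding J_def using F_sub by blast
  obtain a0 where a0: "a0 \<in> Field \<mu>" using \<mu> unfolding cinfinite_def by (metis finite.emptyI ex_in_conv)
  have "|Field \<mu>| \<le>o |Pow V|"
    using ordIso_ordLeq_trans[OF card_of_Field_ordIso ordLeq_transitive[OF V ordLess_imp_ordLeq[OF card_of_Pow]]]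
      \<mu> by blast
  then have J_card: "|J| \<le>o |Pow V|" unfolding J_def using F_card by (intro UNION_Cinfinite_bound[OF _ _ CP]) auto
  have "\<exists>w \<in> J. \<forall>x \<in> X. (x, w) \<in> r" if X: "X \<subseteq> J" "|X| <o \<mu>" for X
  proof (cases "X = {}")
    case True
    then show ?thesis using a0 F0[of a0] by (auto simp: J_def)
  next
    case False
    have "|X| \<le>o |V|" using ordLeq_transitive[OF ordLess_imp_ordLeq[OF X(2)] V] .
    then obtain g0 where g0: "g0 ` V = X" using card_of_ordLeq2[OF False, of V] by auto
    obtain a where a: "a \<in> Field \<mu>" "X \<subseteq> F a"
      using regularCard_UNION[OF _ \<mu>(2) F_mono _ X(2)] \<mu>(1) X(1) J_def by blast
    \<comment> \<open>Bounds for families in \<open>F a\<close> enter only at stages strictly above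
      \<open>a\<close>. Such a stage exists because an infinite cardinal has no last
      element.\<close>
    obtain b where b: "b \<in> Field \<mu>" "a \<noteq> b" "(a, b) \<in> \<mu>"
      using infinite_Card_order_limit[OF _ _ a(1)] \<mu>(1) unfolding cinfinite_def by blast
    define g where "g x = (if x \<in> V then g0 x else undefined)" for x
    have gX: "g ` V = X" using g0 by (simp add: g_def)
    have "a \<in> underS \<mu> b" using b by (simp add: underS_def)
    then have "g \<in> Func V (\<Union>c \<in> underS \<mu> b. F c)" unfolding Func_def g_def using g0 a(2) by auto
    then have "U g \<in> F b" unfolding F[of b] by blast
    moreover have "\<exists>w \<in> Field r. \<forall>x \<in> g ` V. (x, w) \<in> r"
      using r X J_sub gX unfolding directed_poset_def by blast
    ultimately show ?thesis using U(2)[of g] gX b(1) by (auto simp: J_def)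
  qed
  then have bound: "\<exists>w \<in> J. \<forall>x \<in> X. (x, w) \<in> Restr r J" if "X \<subseteq> J" "|X| <o \<mu>" for X
    using that by (metis (no_types, lifting) IntI SigmaI subsetD)
  have "directed_poset \<mu> (Restr r J)"
    unfolding directed_poset_def
  proof (intro conjI allI impI)
    show "Partial_order (Restr r J)" by (rule Partial_order_Restr[OF po])
    show "\<exists>u\<in>Field (Restr r J). \<forall>x\<in>X. (x, u) \<in> Restr r J"
      if "X \<subseteq> Field (Restr r J)" "|X| <o \<mu>" for X
      using bound[of X] that unfolding Partial_order_Field_Restr[OF po J_sub] .
  qed
  moreover have "J0 \<subseteq> J" using a0 F0[of a0] by (auto simp: J_def)
  ultimately show ?thesis using J_sub J_card by blast
qed

section \<open>Chains of large regular length\<close>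

text \<open>The successor cardinal of \<open>|Pow V|\<close> is regular, so every set of at most
  \<open>|Pow V|\<close> of its elements is bounded; it is small because it is at most a further
  power set. It is then transported to a set of elements of \<open>'u\<close>.\<close>

lemma long_chain_exists:
  fixes \<kappa> :: "'u rel" and V :: "'u set"
  assumes \<kappa>: "inaccessible \<kappa>" and V: "small \<kappa> V" "infinite V"
  shows "\<exists>W :: 'u set. infinite W \<and> small \<kappa> W \<and> bounded_by |Pow V| |W|"
proof -
  have C\<kappa>: "Cinfinite \<kappa>" by (rule inaccessible_Cinfinite[OF \<kappa>])
  have pow: "|Pow A| <o \<kappa>" if "|A| <o \<kappa>" for A :: "'u set" using \<kappa> that unfolding inaccessible_def by blast
  have "|Pow V| <o \<kappa>" using pow V(1) by (simp add: small_def)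
  \<comment> \<open>\<open>Pow V\<close> is replaced by an equipotent set of elements of
    \<open>'u\<close>, since closure of \<open>\<kappa>\<close> under power sets is formulated for
    those.\<close>
  then obtain \<Theta> :: "'u set" where \<Theta>: "|Pow V| =o |\<Theta>|" "|\<Theta>| <o \<kappa>"
    using iffD1[OF internalize_card_of_ordLess] by metis
  have C\<Theta>: "Cinfinite |\<Theta>|" using Cinfinite_cong[OF \<Theta>(1) Cinfinite_Pow[OF V(2)]] .
  have "cardSuc |\<Theta>| \<le>o |Pow \<Theta>|" by (rule cardSuc_least[OF card_of_Card_order card_of_Card_order card_of_Pow])
  then have s\<kappa>: "cardSuc |\<Theta>| <o \<kappa>" using ordLeq_ordLess_trans pow[OF \<Theta>(2)] by blast
  have Cs: "Cinfinite (cardSuc |\<Theta>| )" using Cinfinite_cardSuc[OF C\<Theta>] .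
  have fs: "|Field (cardSuc |\<Theta>| )| =o cardSuc |\<Theta>|" using card_of_Field_ordIso Cs by blast
  obtain W :: "'u set" where W: "|Field (cardSuc |\<Theta>| )| =o |W|" "|W| <o \<kappa>"
    using iffD1[OF internalize_card_of_ordLess, OF ordIso_ordLess_trans[OF fs s\<kappa>]] by metis
  have sW: "cardSuc |\<Theta>| =o |W|" using ordIso_transitive[OF ordIso_symmetric[OF fs] W(1)] .
  have CW: "Cinfinite |W|" using Cinfinite_cong[OF sW Cs] .
  have rW: "regularCard |W|" using regularCard_ordIso[OF sW Cs regularCard_cardSuc[OF C\<Theta>]] .
  have "bounded_by |Pow V| |W|"
    unfolding bounded_by_def
  proof (intro allI impI)
    fix S assume S: "S \<subseteq> Field |W|" "|S| \<le>o |Pow V|"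
    have "|S| <o cardSuc |\<Theta>|"
      using ordLeq_ordLess_trans[OF ordLeq_ordIso_trans[OF S(2) \<Theta>(1)] cardSuc_greater[OF card_of_Card_order]] .
    then have "|S| <o |W|" using ordLess_ordIso_trans sW by blast
    then show "\<exists>u\<in>Field |W|. \<forall>s\<in>S. (s, u) \<in> |W|"
      using regularCard_bounded[OF card_of_Card_order rW S(1)] by blast
  qed
  moreover have "infinite W" using CW by (simp add: cinfinite_def Field_card_of)
  ultimately show ?thesis using W(2) unfolding small_def by blast
qed

section \<open>Small directed parts of a directed poset\<close>

text \<open>Ordered by inclusion, these parts turn a \<open>\<mu>\<close>-directed colimit into one
  that is directed for families of size \<open>|Pow V|\<close>, whose terms are again
  \<open>\<mu>\<close>-directed colimits.\<close>

definition directed_parts :: "'u rel \<Rightarrow> 'u set \<Rightarrow> 'u rel \<Rightarrow> 'u set set" where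
  "directed_parts \<mu> V r = {J. J \<subseteq> Field r \<and> |J| \<le>o |Pow V| \<and> directed_poset \<mu> (Restr r J)}"

definition inclusion_order :: "'i set set \<Rightarrow> 'i set rel" where
  "inclusion_order \<J> = {(a, b). a \<in> \<J> \<and> b \<in> \<J> \<and> a \<subseteq> b}"

lemma Field_inclusion_order [simp]: "Field (inclusion_order \<J>) = \<J>"
  by (auto simp: inclusion_order_def Field_def)

lemma trans_inclusion_order: "trans (inclusion_order \<J>)"
  by (auto simp: inclusion_order_def trans_def)

text \<open>The union of at most \<open>|Pow V|\<close> parts has again at most
  \<open>|Pow V|\<close> elements, and its directed closure is a part containing them all.\<close>

lemma bounded_by_directed_parts:
  fixes \<mu> r :: "'u rel" and V :: "'u set"
  assumes \<mu>: "Cinfinite \<mu>" "regularCard \<mu>" and V: "\<mu> \<le>o |V|" and r: "directed_poset \<mu> r"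
  shows "bounded_by |Pow V| (inclusion_order (directed_parts \<mu> V r))"
  unfolding bounded_by_def Field_inclusion_order
proof (intro allI impI)
  fix S assume S: "S \<subseteq> directed_parts \<mu> V r" "|S| \<le>o |Pow V|"
  have "infinite V" using cinfinite_mono[OF V] \<mu> by (simp add: cinfinite_def Field_card_of)
  then have "|\<Union>J \<in> S. J| \<le>o |Pow V|"
    using S by (intro UNION_Cinfinite_bound[OF _ _ Cinfinite_Pow]) (auto simp: directed_parts_def)
  moreover have "(\<Union>J \<in> S. J) \<subseteq> Field r" using S(1) by (auto simp: directed_parts_def)
  ultimately obtain J where J: "(\<Union>J \<in> S. J) \<subseteq> J" "J \<subseteq> Field r" "|J| \<le>o |Pow V|" "directed_poset \<mu> (Restr r J)"
    using directed_closure[OF \<mu> V r, of "\<Union>J \<in> S. J"] by metis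
  then have "J \<in> directed_parts \<mu> V r" by (simp add: directed_parts_def)
  moreover have "\<forall>s \<in> S. (s, J) \<in> inclusion_order (directed_parts \<mu> V r)" using J(1) S(1) calculation by (auto simp: inclusion_order_def)
  ultimately show "\<exists>u\<in>directed_parts \<mu> V r. \<forall>s\<in>S. (s, u) \<in> inclusion_order (directed_parts \<mu> V r)" by blast
qed

section \<open>Independent chains\<close>

lemma small_subset: "small \<kappa> A \<Longrightarrow> B \<subseteq> A \<Longrightarrow> small \<kappa> B"
  unfolding small_def using card_of_mono1 ordLeq_ordLess_trans by blast

text \<open>Transfinite recursion: bound the chain built so far by some \<open>Y\<close>, then
  amalgamate \<open>A\<close> -> \<open>Y\<close> independently with \<open>ab\<close>. One new copy
  \<open>b i\<close> of \<open>B\<close> serves all earlier \<open>j\<close>, since left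
  monotonicity passes from \<open>Y\<close> to each \<open>D j\<close>.\<close>

lemma (in independence) independent_chain:
  fixes \<kappa> r :: "'u rel"
  assumes cb: "has_chain_bounds \<kappa> K" and r: "Well_order r" "small \<kappa> (Field r)"
    and least: "\<And>i. i \<in> Field r \<Longrightarrow> (least, i) \<in> r" and ab: "ab \<in> hom K A B"
  shows "\<exists>D d b. diagram K r D d \<and> (least \<in> Field r \<longrightarrow> D least = A) \<and>
    (\<forall>i j. (j, i) \<in> r \<and> j \<noteq> i \<longrightarrow> (d least j, ab, d j i, b i) \<in> I)"
proof -
  have rf: "(i, i) \<in> r" if "i \<in> Field r" for i using r(1) that by (auto simp: order_on_defs refl_on_def)
  have tr: "(i, k) \<in> r" if "(i, j) \<in> r" "(j, k) \<in> r" for i j k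
    using r(1) that by (auto simp: order_on_defs dest: transD)
  have an: "i = j" if "(i, j) \<in> r" "(j, i) \<in> r" for i j
    using r(1) that by (auto simp: order_on_defs dest: antisymD)
  have Fl: "i \<in> Field r" "j \<in> Field r" if "(i, j) \<in> r" for i j using that by (auto simp: Field_def)
  \<comment> \<open>The recursion value at \<open>i\<close> is a triple: the object at
    \<open>i\<close>, the arrows into it from the objects at all \<open>j\<close> up to
    \<open>i\<close>, and the copy of \<open>B\<close> added there.\<close>
  define ob where "ob F i = fst (F i)" for F :: "'u \<Rightarrow> 'o \<times> ('u \<Rightarrow> 'm) \<times> 'm" and i
  define ar where "ar F j i = fst (snd (F i)) j" for F :: "'u \<Rightarrow> 'o \<times> ('u \<Rightarrow> 'm) \<times> 'm" and j i
  define Q where "Q F i S \<longleftrightarrow> (case S of (X, e, b) \<Rightarrow> i \<in> Field r \<longrightarrow>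
     X \<in> Obj K \<and> e i = Id K X \<and> (i = least \<longrightarrow> X = A) \<and>
     (\<forall>j \<in> underS r i. e j \<in> hom K (ob F j) X \<and> (\<forall>k. (k, j) \<in> r \<longrightarrow> e j \<cdot> ar F k j = e k) \<and>
        (ar F least j, ab, e j, b) \<in> I))" for F i S
  have diag: "diagram K (Restr r T) (ob F) (ar F)"
    if good: "\<And>i. i \<in> T \<Longrightarrow> Q F i (F i)" and T: "T \<subseteq> Field r" for F T
  proof -
    have q: "ob F i \<in> Obj K" "ar F i i = Id K (ob F i)"
      "\<And>j. j \<in> underS r i \<Longrightarrow> ar F j i \<in> hom K (ob F j) (ob F i)"
      "\<And>j k. j \<in> underS r i \<Longrightarrow> (k, j) \<in> r \<Longrightarrow> ar F j i \<cdot> ar F k j = ar F k i" if i: "i \<in> T" for i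
    proof -
      obtain X e b where F: "F i = (X, e, b)" by (cases "F i") auto
      have "Q F i (X, e, b)" using good[OF i] F by simp
      then show "ob F i \<in> Obj K" "ar F i i = Id K (ob F i)"
        "\<And>j. j \<in> underS r i \<Longrightarrow> ar F j i \<in> hom K (ob F j) (ob F i)"
        "\<And>j k. j \<in> underS r i \<Longrightarrow> (k, j) \<in> r \<Longrightarrow> ar F j i \<cdot> ar F k j = ar F k i"
        using i T unfolding Q_def by (auto simp: ob_def[of F i] ar_def[of F _ i] F)
    qed
    have h: "ar F j i \<in> hom K (ob F j) (ob F i)" if "(j, i) \<in> r" "i \<in> T" for i j
      using q(1,2)[OF that(2)] q(3)[OF that(2), of j] that(1) Id_in_hom[of "ob F i"]
      by (cases "j = i") (auto simp: underS_def)
    show ?thesis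
      unfolding diagram_def
    proof (intro conjI ballI allI impI)
      show "ob F i \<in> Obj K" "ar F i i = Id K (ob F i)" if "i \<in> Field (Restr r T)" for i
        using that q(1,2)[of i] by (auto simp: Field_def)
      show "ar F i j \<in> hom K (ob F i) (ob F j)" if "(i, j) \<in> Restr r T" for i j using h that by blast
      fix i j k assume ij: "(i, j) \<in> Restr r T" and jk: "(j, k) \<in> Restr r T"
      show "ar F i k = ar F j k \<cdot> ar F i j"
      proof (cases "j = k")
        case True
        then show ?thesis using q(2)[of k] jk Id_Comp[OF h[of i j]] ij by simp
      next
        case False
        then show ?thesis using q(4)[of k j i] ij jk by (simp add: underS_def)
      qed
    qed
  qed
  have wf: "wf (r - Relation.Id)" using r(1) by (simp add: well_order_on_def)
  have "\<exists>F. \<forall>i. Q F i (F i)"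
  proof (rule dependent_wf_choice[OF wf])
    fix F G :: "'u \<Rightarrow> 'o \<times> ('u \<Rightarrow> 'm) \<times> 'm" and i S
    assume "\<And>z. (z, i) \<in> r - Relation.Id \<Longrightarrow> F z = G z"
    then have eq: "F j = G j" if "j \<in> underS r i" for j using that by (simp add: underS_def)
    then have "ob F j = ob G j" "ar F k j = ar G k j" if "j \<in> underS r i" for j k
      using that by (simp_all add: ob_def ar_def)
    then show "Q F i S = Q G i S" unfolding Q_def by (auto split: prod.split)
  next
    fix i and F :: "'u \<Rightarrow> 'o \<times> ('u \<Rightarrow> 'm) \<times> 'm"
    assume "\<And>y. (y, i) \<in> r - Relation.Id \<Longrightarrow> Q F y (F y)"
    then have good: "Q F j (F j)" if "j \<in> underS r i" for j using that by (simp add: underS_def)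
    have A: "A \<in> Obj K" using hom_Obj[OF ab] by blast
    show "\<exists>S. Q F i S"
    proof (cases "i \<in> Field r \<and> i \<noteq> least")
      case False
      \<comment> \<open>Outside the field \<open>Q\<close> is vacuous, and at the least element
        nothing precedes; \<open>A\<close> is taken in both cases.\<close>
      then have "i \<in> Field r \<Longrightarrow> i = least \<and> underS r i = {}"
        using least an by (auto simp: underS_def Field_def)
      then have "Q F i (A, \<lambda>_. Id K A, ab)" unfolding Q_def using A by simp
      then show ?thesis by blast
    next
      case True
      have us: "underS r i \<subseteq> Field r" by (auto simp: underS_def Field_def)
      let ?r = "Restr r (underS r i)"
      have Fr: "Field ?r = underS r i" by (rule Refl_Field_Restr2[OF _ us]) (use r(1) in \<open>simp add: order_on_defs\<close>)
      have dg: "diagram K ?r (ob F) (ar F)" by (rule diag[OF good us])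
      have "Well_order ?r" by (rule Well_order_Restr[OF r(1)])
      moreover have "small \<kappa> (Field ?r)" unfolding Fr by (rule small_subset[OF r(2) us])
      \<comment> \<open>Successor and limit stages are treated alike; \<open>Y\<close> is any bound
        of the strictly earlier stages.\<close>
      ultimately obtain Y c where c: "cocone K ?r (ob F) (ar F) Y c"
        using cb dg unfolding has_chain_bounds_def by blast
      have bi: "least \<in> underS r i" using True least by (auto simp: underS_def)
      obtain X0 e0 b0 where F0: "F least = (X0, e0, b0)" by (cases "F least") auto
      have "ob F least = A" using good[OF bi] bi us unfolding F0 Q_def by (auto simp: ob_def F0)
      then have cbot: "c least \<in> hom K A Y" using cocone_homD[OF c, of least] bi Fr by simp
      obtain bd cd where sq: "(c least, ab, bd, cd) \<in> I"
        using existence homD[OF cbot] homD[OF ab] unfolding has_existence_def by metis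
      define Z where "Z = Cod K cd"
      have bd: "bd \<in> hom K Y Z" using indepD(3)[OF notion sq] homD[OF cbot] by (simp add: Z_def)
      define e where "e j = (if j = i then Id K Z else bd \<cdot> c j)" for j
      have ei: "e j = bd \<cdot> c j" if "j \<in> underS r i" for j using that by (simp add: e_def underS_def)
      have "Q F i (Z, e, cd)"
        unfolding Q_def prod.case
      proof (intro impI conjI ballI allI)
        show "Z \<in> Obj K" using hom_Obj[OF bd] by blast
        show "e i = Id K Z" by (simp add: e_def)
        show "Z = A" if "i = least" using that True by blast
        fix j assume j: "j \<in> underS r i"
        have cj: "c j \<in> hom K (ob F j) Y" using cocone_homD[OF c, of j] j Fr by simp
        show "e j \<in> hom K (ob F j) Z" unfolding ei[OF j] by (rule Comp_in_hom[OF cj bd])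
        have step: "(k, j) \<in> ?r" if "(k, j) \<in> r" for k
          using that j tr an by (auto simp: underS_def)
        show "e j \<cdot> ar F k j = e k" if kj: "(k, j) \<in> r" for k
        proof -
          have "k \<in> underS r i" using step[OF kj] by blast
          then show ?thesis using ei j Comp_assoc[OF diagram_homD[OF dg step[OF kj]] cj bd]
              cocone_comp[OF c step[OF kj]] by simp
        qed
        have bj: "(least, j) \<in> r" using least us j by blast
        have ba: "ar F least j \<in> hom K (ob F least) (ob F j)" using diagram_homD[OF dg step[OF bj]] .
        show "(ar F least j, ab, e j, cd) \<in> I"
          unfolding ei[OF j]
          by (rule left_monotonic[OF _ ba cj bd]) (simp add: cocone_comp[OF c step[OF bj]] sq)
      qed
      then show ?thesis by blast
    qed
  qed
  then obtain F where F: "\<And>i. Q F i (F i)" by blast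
  have Rr: "Restr r (Field r) = r" by (auto simp: Field_def)
  have "diagram K r (ob F) (ar F)" using diag[of "Field r" F] F Rr by auto
  moreover have "ob F least = A" if "least \<in> Field r"
    using F[of least] that unfolding Q_def by (auto simp: ob_def split: prod.splits)
  moreover have "(ar F least j, ab, ar F j i, snd (snd (F i))) \<in> I" if "(j, i) \<in> r" "j \<noteq> i" for i j
    using F[of i] that Fl unfolding Q_def by (auto simp: ar_def[of F j i] underS_def split: prod.splits)
  ultimately show ?thesis
    by (intro exI[of _ "ob F"] exI[of _ "ar F"] exI[of _ "\<lambda>i. snd (snd (F i))"]) simp
qed

section \<open>Subdiagrams\<close>

lemma diagram_Restr:
  assumes "diagram K r D d"
  shows "diagram K (Restr r J) D d"
  unfolding diagram_def
proof (intro conjI ballI allI impI)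
  have "i \<in> Field r" if "i \<in> Field (Restr r J)" for i using that by (auto simp: Field_def)
  then show "D i \<in> Obj K" "d i i = Id K (D i)" if "i \<in> Field (Restr r J)" for i
    using assms that by (auto simp: diagram_def)
  show "d i j \<in> hom K (D i) (D j)" if "(i, j) \<in> Restr r J" for i j
    using diagram_homD[OF assms, of i j] that by blast
  show "d i k = d j k \<cdot>\<^bsub>K\<^esub> d i j" if "(i, j) \<in> Restr r J" "(j, k) \<in> Restr r J" for i j k
    using diagram_comp[OF assms, of i j k] that by blast
qed

context category
begin

text \<open>A cocone restricts to every subdiagram, so the universal properties give the comparison
  arrows between the partial colimits and into \<open>L\<close>. Functoriality holds because arrows
  out of \<open>g a\<close> are determined by the legs \<open>q a\<close>.\<close>

lemma subdiagram_colimits: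
  assumes dg: "diagram K r D d" and c: "cocone K r D d L c"
    and col: "\<And>J. J \<in> \<J> \<Longrightarrow> colimit K (Restr r J) D d (g J) (q J)"
    and fld: "\<And>J. J \<in> \<J> \<Longrightarrow> Field (Restr r J) = J"
  shows "\<exists>e l. diagram K (inclusion_order \<J>) g e \<and> cocone K (inclusion_order \<J>) g e L l \<and>
    (\<forall>a \<in> \<J>. \<forall>j \<in> a. l a \<cdot> q a j = c j) \<and>
    (\<forall>(a, b) \<in> inclusion_order \<J>. \<forall>j \<in> a. e a b \<cdot> q a j = q b j)"
proof -
  have q: "q a j \<in> hom K (D j) (g a)" if "a \<in> \<J>" "j \<in> a" for a j
    using cocone_homD[OF colimit_cocone[OF col[OF that(1)]]] fld[OF that(1)] that(2) by blast
  have "\<exists>h. h \<in> hom K (g a) L \<and> (\<forall>j \<in> a. h \<cdot> q a j = c j)" if a: "a \<in> \<J>" for a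
  proof -
    have "a \<subseteq> Field r" using fld[OF a] by (auto simp: Field_def)
    then have "cocone K (Restr r a) D d L c" using c fld[OF a] by (auto simp: cocone_def)
    then show ?thesis using colimit_factor[OF col[OF a], of L c] fld[OF a] by metis
  qed
  then obtain l where l: "\<And>a. a \<in> \<J> \<Longrightarrow> l a \<in> hom K (g a) L" "\<And>a j. a \<in> \<J> \<Longrightarrow> j \<in> a \<Longrightarrow> l a \<cdot> q a j = c j"
    by metis
  have "\<exists>h. h \<in> hom K (g a) (g b) \<and> (\<forall>j \<in> a. h \<cdot> q a j = q b j)" if ab: "(a, b) \<in> inclusion_order \<J>" for a b
  proof -
    have ab': "a \<in> \<J>" "b \<in> \<J>" "a \<subseteq> b" using ab by (auto simp: inclusion_order_def)
    have "cocone K (Restr r b) D d (g b) (q b)" using colimit_cocone[OF col[OF ab'(2)]] .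
    then have "cocone K (Restr r a) D d (g b) (q b)"
      using ab'(3) fld[OF ab'(1)] fld[OF ab'(2)] by (simp add: cocone_def) blast
    then show ?thesis using colimit_factor[OF col[OF ab'(1)], of "g b" "q b"] fld[OF ab'(1)] by metis
  qed
  then obtain e where e: "\<And>a b. (a, b) \<in> inclusion_order \<J> \<Longrightarrow> e a b \<in> hom K (g a) (g b)"
    "\<And>a b j. (a, b) \<in> inclusion_order \<J> \<Longrightarrow> j \<in> a \<Longrightarrow> e a b \<cdot> q a j = q b j" by metis
  have eq: "u = v" if "a \<in> \<J>" "u \<in> hom K (g a) Y" "v \<in> hom K (g a) Y" "\<And>j. j \<in> a \<Longrightarrow> u \<cdot> q a j = v \<cdot> q a j" for a u v Y
    using colimit_eqI[OF col[OF that(1)] diagram_Restr[OF dg] that(2,3)] that(4) fld[OF that(1)] by blast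
  have "diagram K (inclusion_order \<J>) g e"
    unfolding diagram_def Field_inclusion_order
  proof (intro conjI ballI allI impI)
    show go: "g a \<in> Obj K" if "a \<in> \<J>" for a using hom_Obj[OF l(1)[OF that]] by blast
    show "e a b \<in> hom K (g a) (g b)" if "(a, b) \<in> inclusion_order \<J>" for a b by (rule e(1)[OF that])
    show "e a a = Id K (g a)" if a: "a \<in> \<J>" for a
    proof -
      have aa: "(a, a) \<in> inclusion_order \<J>" using a by (simp add: inclusion_order_def)
      show ?thesis
        by (rule eq[OF a e(1)[OF aa] Id_in_hom[OF go[OF a]]]) (simp add: e(2)[OF aa] Id_Comp[OF q[OF a]])
    qed
    fix a b k assume ab: "(a, b) \<in> inclusion_order \<J>" and bk: "(b, k) \<in> inclusion_order \<J>"
    have ak: "(a, k) \<in> inclusion_order \<J>" "a \<in> \<J>" "a \<subseteq> b" using ab bk by (auto simp: inclusion_order_def)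
    show "e a k = e b k \<cdot> e a b"
    proof (rule eq[OF ak(2) e(1)[OF ak(1)] Comp_in_hom[OF e(1)[OF ab] e(1)[OF bk]]])
      fix j assume j: "j \<in> a"
      show "e a k \<cdot> q a j = e b k \<cdot> e a b \<cdot> q a j"
        using Comp_assoc[OF q[OF ak(2) j] e(1)[OF ab] e(1)[OF bk]] e(2)[OF ab j] e(2)[OF ak(1) j] e(2)[OF bk, of j] ak(3) j
        by auto
    qed
  qed
  moreover have "cocone K (inclusion_order \<J>) g e L l"
    unfolding cocone_def Field_inclusion_order
  proof (intro conjI ballI allI impI)
    show "L \<in> Obj K" using c by (simp add: cocone_def)
    show "l a \<in> hom K (g a) L" if "a \<in> \<J>" for a by (rule l(1)[OF that])
    fix a b assume ab: "(a, b) \<in> inclusion_order \<J>"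
    have ab': "a \<in> \<J>" "b \<in> \<J>" "a \<subseteq> b" using ab by (auto simp: inclusion_order_def)
    show "l b \<cdot> e a b = l a"
    proof (rule eq[OF ab'(1) Comp_in_hom[OF e(1)[OF ab] l(1)[OF ab'(2)]] l(1)[OF ab'(1)]])
      fix j assume j: "j \<in> a"
      show "l b \<cdot> e a b \<cdot> q a j = l a \<cdot> q a j"
        using Comp_assoc[OF q[OF ab'(1) j] e(1)[OF ab] l(1)[OF ab'(2)]] e(2)[OF ab j] l(2)[OF ab'(1) j]
          l(2)[OF ab'(2), of j] ab'(3) j by auto
    qed
  qed
  ultimately show ?thesis using l(2) e(2) by (intro exI[of _ e] exI[of _ l]) auto
qed

text \<open>Tameness passes from a diagram to the system of its partial colimits. An arrow into
  \<open>L\<close> factors through some \<open>D j\<close>, hence through any part containing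
  \<open>j\<close>. Two arrows into \<open>g J\<close> lift to one \<open>D j\<close> with
  \<open>j\<close> in \<open>J\<close>; they are equalized at some \<open>k\<close>, hence in a part
  enlarged by \<open>k\<close>.\<close>

lemma tame_subdiagrams:
  assumes dg: "diagram K r D d"
    and tm: "tame K r D d L c X"
    and q: "\<And>J. J \<in> \<J> \<Longrightarrow> cocone K (Restr r J) D d (g J) (q J)"
    and tmJ: "\<And>J. J \<in> \<J> \<Longrightarrow> tame K (Restr r J) D d (g J) (q J) X"
    and fld: "\<And>J. J \<in> \<J> \<Longrightarrow> Field (Restr r J) = J"
    and dir: "\<And>J i j. J \<in> \<J> \<Longrightarrow> i \<in> J \<Longrightarrow> j \<in> J \<Longrightarrow> \<exists>k. (i, k) \<in> Restr r J \<and> (j, k) \<in> Restr r J"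
    and single: "\<And>j. j \<in> Field r \<Longrightarrow> \<exists>J \<in> \<J>. j \<in> J"
    and enlarge: "\<And>J j. J \<in> \<J> \<Longrightarrow> j \<in> Field r \<Longrightarrow> \<exists>J' \<in> \<J>. J \<subseteq> J' \<and> j \<in> J'"
    and e: "diagram K (inclusion_order \<J>) g e" and l: "cocone K (inclusion_order \<J>) g e L l"
    and lq: "\<And>a j. a \<in> \<J> \<Longrightarrow> j \<in> a \<Longrightarrow> l a \<cdot> q a j = c j"
    and eq: "\<And>a b j. (a, b) \<in> inclusion_order \<J> \<Longrightarrow> j \<in> a \<Longrightarrow> e a b \<cdot> q a j = q b j"
  shows "tame K (inclusion_order \<J>) g e L l X"
  unfolding tame_def Field_inclusion_order
proof (intro conjI ballI impI)
  have qh: "q a j \<in> hom K (D j) (g a)" if "a \<in> \<J>" "j \<in> a" for a j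
    using cocone_homD[OF q[OF that(1)]] fld[OF that(1)] that(2) by blast
  have lh: "l a \<in> hom K (g a) L" if "a \<in> \<J>" for a using cocone_homD[OF l, of a] that by simp
  fix h assume "h \<in> hom K X L"
  then obtain j w where w: "j \<in> Field r" "w \<in> hom K X (D j)" "c j \<cdot> w = h" using tame_factor[OF tm] by blast
  then obtain J where J: "J \<in> \<J>" "j \<in> J" using single by blast
  have "l J \<cdot> (q J j \<cdot> w) = h"
    using Comp_assoc[OF w(2) qh[OF J] lh[OF J(1)]] lq[OF J] w(3) by simp
  then show "\<exists>i\<in>\<J>. \<exists>g\<in>hom K X (g i). l i \<cdot> g = h"
    using Comp_in_hom[OF w(2) qh[OF J]] J(1) by blast
next
  have qh: "q a j \<in> hom K (D j) (g a)" if "a \<in> \<J>" "j \<in> a" for a j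
    using cocone_homD[OF q[OF that(1)]] fld[OF that(1)] that(2) by blast
  have lh: "l a \<in> hom K (g a) L" if "a \<in> \<J>" for a using cocone_homD[OF l, of a] that by simp
  fix J u v assume J: "J \<in> \<J>" and u: "u \<in> hom K X (g J)" and v: "v \<in> hom K X (g J)" and luv: "l J \<cdot> u = l J \<cdot> v"
  have fac: "\<exists>j \<in> J. \<exists>w \<in> hom K X (D j). q J j \<cdot> w = u" if "u \<in> hom K X (g J)" for u
    using tame_factor[OF tmJ[OF J] that] fld[OF J] by blast
  obtain j1 u1 where u1: "j1 \<in> J" "u1 \<in> hom K X (D j1)" "q J j1 \<cdot> u1 = u" using fac[OF u] by blast
  obtain j2 v2 where v2: "j2 \<in> J" "v2 \<in> hom K X (D j2)" "q J j2 \<cdot> v2 = v" using fac[OF v] by blast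
  obtain j where j: "(j1, j) \<in> Restr r J" "(j2, j) \<in> Restr r J" using dir[OF J u1(1) v2(1)] by blast
  have jJ: "j \<in> J" using j by blast
  note d1 = diagram_homD[OF diagram_Restr[OF dg] j(1)] and d2 = diagram_homD[OF diagram_Restr[OF dg] j(2)]
  define u' where "u' = d j1 j \<cdot> u1"
  define v' where "v' = d j2 j \<cdot> v2"
  have u': "u' \<in> hom K X (D j)" "q J j \<cdot> u' = u"
    using Comp_in_hom[OF u1(2) d1] Comp_assoc[OF u1(2) d1 qh[OF J jJ]] cocone_comp[OF q[OF J] j(1)] u1(3)
    by (simp_all add: u'_def)
  have v': "v' \<in> hom K X (D j)" "q J j \<cdot> v' = v"
    using Comp_in_hom[OF v2(2) d2] Comp_assoc[OF v2(2) d2 qh[OF J jJ]] cocone_comp[OF q[OF J] j(2)] v2(3)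
    by (simp_all add: v'_def)
  have jr: "j \<in> Field r" using j by (auto simp: Field_def)
  have "c j \<cdot> u' = c j \<cdot> v'"
    using Comp_assoc[OF u'(1) qh[OF J jJ] lh[OF J]] Comp_assoc[OF v'(1) qh[OF J jJ] lh[OF J]]
      lq[OF J jJ] u'(2) v'(2) luv by simp
  then obtain k where k: "(j, k) \<in> r" "d j k \<cdot> u' = d j k \<cdot> v'"
    using tame_equalize[OF tm jr u'(1) v'(1)] by blast
  have "k \<in> Field r" using k(1) by (auto simp: Field_def)
  then obtain J' where J': "J' \<in> \<J>" "J \<subseteq> J'" "k \<in> J'" using enlarge[OF J] by blast
  have JJ': "(J, J') \<in> inclusion_order \<J>" using J J' by (simp add: inclusion_order_def)
  have jk: "(j, k) \<in> Restr r J'" using k(1) J' jJ by blast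
  have eh: "e J J' \<in> hom K (g J) (g J')" using diagram_homD[OF e JJ'] .
  have ew: "e J J' \<cdot> (q J j \<cdot> w) = q J' k \<cdot> (d j k \<cdot> w)" if "w \<in> hom K X (D j)" for w
    using Comp_assoc[OF that qh[OF J jJ] eh] eq[OF JJ' jJ]
      Comp_assoc[OF that diagram_homD[OF dg k(1)] qh[OF J'(1,3)]] cocone_comp[OF q[OF J'(1)] jk] by simp
  have "e J J' \<cdot> u = e J J' \<cdot> v" using ew[OF u'(1)] ew[OF v'(1)] u'(2) v'(2) k(2) by simp
  then show "\<exists>j. (J, j) \<in> inclusion_order \<J> \<and> e J j \<cdot> u = e J j \<cdot> v" using JJ' by blast
qed

end

text \<open>\<open>emb\<close> is full, and \<open>lower\<close> recovers an arrow from its image,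
  so factorizations and equalities descend from \<open>E\<close> to \<open>K\<close>.\<close>

lemma (in independence) tame_emb:
  assumes dg: "diagram K r D d" and c: "cocone K r D d L c" and X: "X \<in> Obj K"
    and tm: "tame E r (\<lambda>i. Id K (D i)) (\<lambda>i j. emb (d i j)) (Id K L) (\<lambda>i. emb (c i)) (Id K X)"
  shows "tame K r D d L c X"
  unfolding tame_def
proof (intro conjI ballI impI)
  have D: "D i \<in> Obj K" if "i \<in> Field r" for i using dg that by (simp add: diagram_def)
  fix h assume h: "h \<in> hom K X L"
  obtain i g where g: "i \<in> Field r" "g \<in> hom E (Id K X) (Id K (D i))" "emb (c i) \<cdot>\<^bsub>E\<^esub> g = emb h"
    using tame_factor[OF tm emb_in_hom[OF h]] by blast
  note lg = hom_Id_Id[OF X D[OF g(1)] g(2)]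
  have "c i \<cdot> lower g = h"
    using lower_Comp[OF g(2) emb_in_hom[OF cocone_homD[OF c g(1)]]] g(3) by simp
  then show "\<exists>i\<in>Field r. \<exists>g\<in>hom K X (D i). c i \<cdot> g = h" using g(1) lg(2) by blast
next
  fix i u v assume i: "i \<in> Field r" and u: "u \<in> hom K X (D i)" and v: "v \<in> hom K X (D i)"
    and eq: "c i \<cdot> u = c i \<cdot> v"
  have "emb (c i) \<cdot>\<^bsub>E\<^esub> emb u = emb (c i) \<cdot>\<^bsub>E\<^esub> emb v"
    using emb_Comp[OF u cocone_homD[OF c i]] emb_Comp[OF v cocone_homD[OF c i]] eq by simp
  then obtain j where j: "(i, j) \<in> r" "emb (d i j) \<cdot>\<^bsub>E\<^esub> emb u = emb (d i j) \<cdot>\<^bsub>E\<^esub> emb v"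
    using tame_equalize[OF tm i emb_in_hom[OF u] emb_in_hom[OF v]] by blast
  have "d i j \<cdot> u = d i j \<cdot> v"
    using emb_Comp[OF u diagram_homD[OF dg j(1)]] emb_Comp[OF v diagram_homD[OF dg j(1)]] j(2) lower_emb by metis
  then show "\<exists>j. (i, j) \<in> r \<and> d i j \<cdot> u = d i j \<cdot> v" using j(1) by blast
qed

section \<open>Canonicity\<close>

text \<open>The data of \<open>\<mu>\<close>-accessibility of \<open>E\<close> with generators
  \<open>P\<close>, together with a parameter \<open>V\<close> that fixes the size
  \<open>|Pow V|\<close> of all auxiliary colimits.\<close>

locale generated_independence = independence K I
  for K :: "('o, 'm) cat" (structure) and I :: "'m square set" +
  fixes \<kappa> \<mu> :: "'u rel" and V :: "'u set" and P :: "'m set"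
  assumes inaccessible: "inaccessible \<kappa>"
    and \<mu>: "Cinfinite \<mu>" "regularCard \<mu>" and V: "\<mu> \<le>o |V|" "small \<kappa> V"
    and colims: "\<And>(r :: 'u rel) F s. directed_poset \<mu> r \<Longrightarrow> small \<kappa> (Field r) \<Longrightarrow>
      diagram (indep_cat K I) r F s \<Longrightarrow> \<exists>f t. colimit (indep_cat K I) r F s f t"
    and pres: "\<And>p. p \<in> P \<Longrightarrow> presentable \<kappa> \<mu> (indep_cat K I) p"
    and gen: "\<And>f. f \<in> Arr K \<Longrightarrow> \<exists>(r :: 'u rel) F s t. directed_poset \<mu> r \<and> small \<kappa> (Field r) \<and>
      diagram (indep_cat K I) r F s \<and> (\<forall>i \<in> Field r. F i \<in> P) \<and> colimit (indep_cat K I) r F s f t"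
begin

lemma infinite_V: "infinite V"
  using cinfinite_mono[OF V(1)] \<mu>(1) by (simp add: cinfinite_def Field_card_of)

lemma Cinfinite_Pow_V: "Cinfinite |Pow V|"
  by (rule Cinfinite_Pow[OF infinite_V])

text \<open>A size bound relative to \<open>V\<close> that makes \<open>X\<close> presentable for
  \<open>|Pow V|\<close>-bounded diagrams. It is expressed through \<open>Id K X\<close> because the
  generators are objects of \<open>E\<close>, that is, arrows of \<open>K\<close>.\<close>

definition light :: "'o \<Rightarrow> bool" where
  "light X \<longleftrightarrow> X \<in> Obj K \<and>
     (\<exists>(r :: 'u rel) F s t. directed_poset \<mu> r \<and> |Field r| \<le>o |Pow V| \<and> diagram E r F s \<and>
        (\<forall>i \<in> Field r. F i \<in> P) \<and> colimit E r F s (Id K X) t)"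

lemma light_tame:
  assumes X: "light X" and bd: "bounded_by |Pow V| r" and tr: "trans r"
    and dg: "diagram E r D d" and c: "cocone E r D d L c"
    and tm: "\<And>p. p \<in> P \<Longrightarrow> tame E r D d L c p"
  shows "tame E r D d L c (Id K X)"
proof -
  obtain R :: "'u rel" and F s t where R: "directed_poset \<mu> R" "|Field R| \<le>o |Pow V|" "diagram E R F s"
    "\<forall>i \<in> Field R. F i \<in> P" "colimit E R F s (Id K X) t"
    using X unfolding light_def by blast
  show ?thesis
    using E.tame_colimit[OF Cinfinite_Pow_V dg c bd tr R(2) R(3,5)] tm R(4) by blast
qed

lemma directed_partsD:
  assumes J: "directed_poset \<mu> J" "small \<kappa> (Field J)" and a: "a \<in> directed_parts \<mu> V J"
  shows "directed_poset \<mu> (Restr J a)" "Field (Restr J a) = a" "small \<kappa> (Field (Restr J a))" "|a| \<le>o |Pow V|"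
proof -
  have a': "a \<subseteq> Field J" "|a| \<le>o |Pow V|" "directed_poset \<mu> (Restr J a)" using a by (auto simp: directed_parts_def)
  show F: "Field (Restr J a) = a"
    by (rule Partial_order_Field_Restr[OF _ a'(1)]) (use J(1) in \<open>simp add: directed_poset_def\<close>)
  show "small \<kappa> (Field (Restr J a))" unfolding F by (rule small_subset[OF J(2) a'(1)])
qed (use a in \<open>auto simp: directed_parts_def\<close>)

text \<open>After embedding into \<open>E\<close>, each generator is presentable, hence tame for the
  whole diagram and for each part, and so for the system of parts by
  \<open>tame_subdiagrams\<close>. This system is \<open>|Pow V|\<close>-bounded, so tameness
  extends to light objects, and \<open>tame_emb\<close> returns to \<open>K\<close>.\<close>

lemma light_tame_parts:
  fixes J :: "'u rel"
  defines "\<J> \<equiv> directed_parts \<mu> V J"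
  assumes J: "directed_poset \<mu> J" "small \<kappa> (Field J)" and dg: "diagram K J Y y" and col: "colimit K J Y y N c"
    and colJ: "\<And>a. a \<in> \<J> \<Longrightarrow> colimit K (Restr J a) Y y (g a) (q a)"
    and e: "diagram K (inclusion_order \<J>) g e" and l: "cocone K (inclusion_order \<J>) g e N l"
    and lq: "\<And>a j. a \<in> \<J> \<Longrightarrow> j \<in> a \<Longrightarrow> l a \<cdot> q a j = c j"
    and eq: "\<And>a b j. (a, b) \<in> inclusion_order \<J> \<Longrightarrow> j \<in> a \<Longrightarrow> e a b \<cdot> q a j = q b j"
    and X: "light X"
  shows "tame K (inclusion_order \<J>) g e N l X"
proof (rule tame_emb[OF e l])
  show "X \<in> Obj K" using X by (simp add: light_def)
  note JD = directed_partsD[OF J, folded \<J>_def]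
  have bd: "bounded_by |Pow V| (inclusion_order \<J>)"
    unfolding \<J>_def by (rule bounded_by_directed_parts[OF \<mu> V(1) J(1)])
  have qh: "q a j \<in> hom K (Y j) (g a)" if "a \<in> \<J>" "j \<in> a" for a j
    using cocone_homD[OF colimit_cocone[OF colJ[OF that(1)]]] JD(2)[OF that(1)] that(2) by blast
  have lh: "l a \<in> hom K (g a) N" if "a \<in> \<J>" for a using cocone_homD[OF l, of a] that by simp
  show "tame E (inclusion_order \<J>) (\<lambda>a. Id K (g a)) (\<lambda>a b. emb (e a b)) (Id K N) (\<lambda>a. emb (l a)) (Id K X)"
  proof (rule light_tame[OF X bd trans_inclusion_order emb_diagram[OF e] emb_cocone[OF e l]])
    fix p assume p: "p \<in> P"
    show "tame E (inclusion_order \<J>) (\<lambda>a. Id K (g a)) (\<lambda>a b. emb (e a b)) (Id K N) (\<lambda>a. emb (l a)) p"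
    proof (rule E.tame_subdiagrams[where q = "\<lambda>a j. emb (q a j)" and d = "\<lambda>i j. emb (y i j)"
          and D = "\<lambda>i. Id K (Y i)" and c = "\<lambda>i. emb (c i)" and r = J])
      show "diagram E J (\<lambda>i. Id K (Y i)) (\<lambda>i j. emb (y i j))" by (rule emb_diagram[OF dg])
      show "tame E J (\<lambda>i. Id K (Y i)) (\<lambda>i j. emb (y i j)) (Id K N) (\<lambda>i. emb (c i)) p"
        by (rule presentable_tame[OF inaccessible category_indep_cat \<mu>(1) pres[OF p] J
            emb_diagram[OF dg] emb_colimit[OF dg col]])
      show "diagram E (inclusion_order \<J>) (\<lambda>a. Id K (g a)) (\<lambda>a b. emb (e a b))" by (rule emb_diagram[OF e])
      show "cocone E (inclusion_order \<J>) (\<lambda>a. Id K (g a)) (\<lambda>a b. emb (e a b)) (Id K N) (\<lambda>a. emb (l a))"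
        by (rule emb_cocone[OF e l])
      show "\<exists>a \<in> \<J>. j \<in> a" if j: "j \<in> Field J" for j
      proof -
        have "|{j}| \<le>o |Pow V|" by (rule finite_ordLeq_Cinfinite[OF _ Cinfinite_Pow_V]) simp
        then obtain a where "{j} \<subseteq> a \<and> a \<subseteq> Field J \<and> |a| \<le>o |Pow V| \<and> directed_poset \<mu> (Restr J a)"
          using directed_closure[OF \<mu> V(1) J(1), of "{j}"] j by auto
        then show ?thesis unfolding \<J>_def directed_parts_def by blast
      qed
      show "emb (e a b) \<cdot>\<^bsub>E\<^esub> emb (q a j) = emb (q b j)"
        if ab: "(a, b) \<in> inclusion_order \<J>" and j: "j \<in> a" for a b j
      proof -
        have a: "a \<in> \<J>" using ab by (simp add: inclusion_order_def)
        show ?thesis using emb_Comp[OF qh[OF a j] diagram_homD[OF e ab]] eq[OF ab j] by simp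
      qed
      fix a assume a: "a \<in> \<J>"
      show "Field (Restr J a) = a" by (rule JD(2)[OF a])
      have dgJ: "diagram K (Restr J a) Y y" by (rule diagram_Restr[OF dg])
      show "cocone E (Restr J a) (\<lambda>i. Id K (Y i)) (\<lambda>i j. emb (y i j)) (Id K (g a)) (\<lambda>j. emb (q a j))"
        by (rule emb_cocone[OF dgJ colimit_cocone[OF colJ[OF a]]])
      show "tame E (Restr J a) (\<lambda>i. Id K (Y i)) (\<lambda>i j. emb (y i j)) (Id K (g a)) (\<lambda>j. emb (q a j)) p"
        by (rule presentable_tame[OF inaccessible category_indep_cat \<mu>(1) pres[OF p] JD(1)[OF a] JD(3)[OF a]
            emb_diagram[OF dgJ] emb_colimit[OF dgJ colJ[OF a]]])
      show "\<exists>k. (i, k) \<in> Restr J a \<and> (j, k) \<in> Restr J a" if "i \<in> a" "j \<in> a" for i j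
        using directed_poset_pair[OF \<mu>(1) JD(1)[OF a], of i j] that JD(2)[OF a] by metis
      show "\<exists>a' \<in> \<J>. a \<subseteq> a' \<and> j \<in> a'" if j: "j \<in> Field J" for j
      proof -
        have "|{j}| \<le>o |Pow V|" by (rule finite_ordLeq_Cinfinite[OF _ Cinfinite_Pow_V]) simp
        then have "|a \<union> {j}| \<le>o |Pow V|" using Un_Cinfinite_bound[OF JD(4)[OF a] _ Cinfinite_Pow_V] by blast
        moreover have "a \<union> {j} \<subseteq> Field J" using a j by (auto simp: \<J>_def directed_parts_def)
        ultimately obtain a' where "a \<union> {j} \<subseteq> a' \<and> a' \<subseteq> Field J \<and> |a'| \<le>o |Pow V| \<and> directed_poset \<mu> (Restr J a')"
          using directed_closure[OF \<mu> V(1) J(1), of "a \<union> {j}"] by auto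
        then show ?thesis unfolding \<J>_def directed_parts_def by blast
      qed
      show "emb (l a) \<cdot>\<^bsub>E\<^esub> emb (q a j) = emb (c j)" if "j \<in> a" for j
        using emb_Comp[OF qh[OF a that] lh[OF a]] lq[OF a that] by simp
    qed
  qed
qed

end

section \<open>A square independent for both notions\<close>

context generated_independence
begin

text \<open>In the square found, \<open>C\<close> enters the corner through the amalgamation for
  \<open>I1\<close> and \<open>B\<close> as the copy in the stage \<open>D k\<close> of the chain,
  so the right edge is \<open>f \<cdot> m k \<cdot> b k\<close>. Lightness of \<open>A\<close>,
  \<open>C\<close> and the domains of generators allows every arrow involved to be lifted to a
  stage.\<close>

lemma common_square:
  assumes cb: "has_chain_bounds \<kappa> K"
    and I1: "independence_notion K I1" "has_existence K I1" "right_monotonic K I1"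
    and c: "c \<in> hom K A C" and ab: "ab \<in> hom K A B"
    and A: "light A" and C: "light C" and P_light: "\<And>p. p \<in> P \<Longrightarrow> light (Dom K p)"
  shows "\<exists>bd cd. (c, ab, bd, cd) \<in> I1 \<and> (c, ab, bd, cd) \<in> I"
proof -
  obtain W :: "'u set" where W: "infinite W" "small \<kappa> W" "bounded_by |Pow V| |W|"
    using long_chain_exists[OF inaccessible V(2) infinite_V] by blast
  have wo: "Well_order |W|" by (rule card_of_Well_order)
  have WF: "Field |W| = W" by (rule Field_card_of)
  have trW: "trans |W|" and poW: "Partial_order |W|" using wo by (auto simp: order_on_defs)
  \<comment> \<open>The chain is also \<open>\<mu>\<close>-directed, so that its colimit exists and
    presentability of the generators applies to it.\<close>
  have dirW: "directed_poset \<mu> |W|"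
    unfolding directed_poset_def
  proof (intro conjI allI impI)
    show "Partial_order |W|" by (rule poW)
    fix S assume S: "S \<subseteq> Field |W|" "|S| <o \<mu>"
    have "|S| \<le>o |Pow V|"
      using ordLeq_transitive[OF ordLeq_transitive[OF ordLess_imp_ordLeq[OF S(2)] V(1)]
          ordLess_imp_ordLeq[OF card_of_Pow]] .
    then show "\<exists>u\<in>Field |W|. \<forall>x\<in>S. (x, u) \<in> |W|" using W(3) S(1) unfolding bounded_by_def by blast
  qed
  have "W \<noteq> {}" using W(1) by auto
  then obtain z where z: "z \<in> W" "\<And>i. i \<in> W \<Longrightarrow> (z, i) \<in> |W|"
    using wo_rel.minim_in[of "|W|" W] wo_rel.minim_least[of "|W|" W] wo WF
    unfolding wo_rel_def by auto

  obtain D d b where dg: "diagram K |W| D d" and Dz: "D z = A"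
    and ind: "\<And>i j. (j, i) \<in> |W| \<Longrightarrow> j \<noteq> i \<Longrightarrow> (d z j, ab, d j i, b i) \<in> I"
    using independent_chain[OF cb wo _ _ ab, of z, unfolded WF, OF W(2) z(2)] z(1) by blast
  obtain M m where M: "colimit K |W| D d M m"
    using colimit_exists[OF colims[OF dirW] dg] W(2) WF by auto
  note mc = colimit_cocone[OF M]
  have m: "m i \<in> hom K (D i) M" if "i \<in> W" for i using cocone_homD[OF mc] that WF by blast
  have light_W: "tame E |W| (\<lambda>i. Id K (D i)) (\<lambda>i j. emb (d i j)) (Id K M) (\<lambda>i. emb (m i)) (Id K X)"
    if "light X" for X
  proof (rule light_tame[OF that W(3) trW emb_diagram[OF dg] emb_cocone[OF dg mc]])
    fix p assume "p \<in> P"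
    then show "tame E |W| (\<lambda>i. Id K (D i)) (\<lambda>i j. emb (d i j)) (Id K M) (\<lambda>i. emb (m i)) p"
      using presentable_tame[OF inaccessible category_indep_cat \<mu>(1) pres dirW _ emb_diagram[OF dg] emb_colimit[OF dg M]]
        W(2) WF by simp
  qed

  have mz: "m z \<in> hom K A M" using m[OF z(1)] Dz by simp
  obtain nC f where sq1: "(c, m z, nC, f) \<in> I1"
    using I1(2) homD[OF c] homD[OF mz] unfolding has_existence_def by metis
  have f: "f \<in> hom K M (Cod K f)" and nC: "nC \<in> hom K C (Cod K f)" and nCc: "nC \<cdot> c = f \<cdot> m z"
    using indepD[OF I1(1) sq1] homD[OF c] homD[OF mz] by (simp_all add: hom_def)
  obtain J :: "'u rel" and F s t where J: "directed_poset \<mu> J" "small \<kappa> (Field J)"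
    and dgF: "diagram E J F s" and FP: "\<forall>j \<in> Field J. F j \<in> P" and colF: "colimit E J F s f t"
    using gen[OF homD(1)[OF f]] by blast
  \<comment> \<open>The \<open>\<mu>\<close>-directed presentation of \<open>f\<close> is regrouped
    into its small directed parts, because light objects are tame only for
    \<open>|Pow V|\<close>-bounded systems.\<close>
  define \<J> where "\<J> = directed_parts \<mu> V J"
  note JD = directed_partsD[OF J, folded \<J>_def]
  have "\<exists>g q. colimit E (Restr J a) F s g q" if a: "a \<in> \<J>" for a
    using colims[OF JD(1)[OF a] JD(3)[OF a] diagram_Restr[OF dgF]] .
  then obtain g q where colJ: "\<And>a. a \<in> \<J> \<Longrightarrow> colimit E (Restr J a) F s (g a) (q a)" by metis
  obtain e l where e: "diagram E (inclusion_order \<J>) g e" and l: "cocone E (inclusion_order \<J>) g e f l"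
    and lq: "\<forall>a \<in> \<J>. \<forall>j \<in> a. l a \<cdot>\<^bsub>E\<^esub> q a j = t j"
    and eq: "\<forall>(a, b) \<in> inclusion_order \<J>. \<forall>j \<in> a. e a b \<cdot>\<^bsub>E\<^esub> q a j = q b j"
    using E.subdiagram_colimits[of J F s f t \<J> g q, OF dgF colimit_cocone[OF colF] colJ JD(2)] by blast
  have qh: "q a j \<in> hom E (F j) (g a)" if "a \<in> \<J>" "j \<in> a" for a j
    using cocone_homD[OF colimit_cocone[OF colJ[OF that(1)]]] JD(2)[OF that(1)] that(2) by blast
  have lh: "l a \<in> hom E (g a) f" if "a \<in> \<J>" for a using cocone_homD[OF l, of a] that by simp
  have pw: "colimit K J (\<lambda>i. Dom K (F i)) (\<lambda>i j. lower (s i j)) (Dom K f) (\<lambda>i. lower (t i))"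
    "colimit K J (\<lambda>i. Cod K (F i)) (\<lambda>i j. upper (s i j)) (Cod K f) (\<lambda>i. upper (t i))"
    using colimit_pointwise[OF colims[OF J] dgF colF] by auto
  have pwJ: "colimit K (Restr J a) (\<lambda>i. Dom K (F i)) (\<lambda>i j. lower (s i j)) (Dom K (g a)) (\<lambda>i. lower (q a i))"
    "colimit K (Restr J a) (\<lambda>i. Cod K (F i)) (\<lambda>i j. upper (s i j)) (Cod K (g a)) (\<lambda>i. upper (q a i))"
    if a: "a \<in> \<J>" for a
    using colimit_pointwise[OF colims[OF JD(1)[OF a] JD(3)[OF a]] diagram_Restr[OF dgF] colJ[OF a]] by auto
  have Mf: "Dom K f = M" using homD[OF f] by simp
  have lqE: "l a \<cdot>\<^bsub>E\<^esub> q a j = t j" if "a \<in> \<J>" "j \<in> a" for a j using lq that by blast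
  have eqE: "e a a' \<cdot>\<^bsub>E\<^esub> q a j = q a' j" "a \<in> \<J>" if "(a, a') \<in> inclusion_order \<J>" "j \<in> a" for a a' j
    using eq that by (auto simp: inclusion_order_def)
  have tame_up: "tame K (inclusion_order \<J>) (\<lambda>a. Cod K (g a)) (\<lambda>a b. upper (e a b)) (Cod K f) (\<lambda>a. upper (l a)) X"
    if X: "light X" for X
  proof (rule light_tame_parts[OF J upper_diagram[OF dgF] pw(2) _ _ _ _ _ X, folded \<J>_def])
    show "upper (l a) \<cdot> upper (q a j) = upper (t j)" if "a \<in> \<J>" "j \<in> a" for a j
      using upper_Comp[OF qh[OF that] lh[OF that(1)]] lqE[OF that] by simp
    show "upper (e a a') \<cdot> upper (q a j) = upper (q a' j)" if "(a, a') \<in> inclusion_order \<J>" "j \<in> a" for a a' j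
      using upper_Comp[OF qh[OF eqE(2)[OF that] that(2)] diagram_homD[OF e that(1)]] eqE(1)[OF that] by simp
  qed (rule pwJ(2) upper_diagram[OF e] upper_cocone[OF e l]; assumption?)+
  have tame_low: "tame K (inclusion_order \<J>) (\<lambda>a. Dom K (g a)) (\<lambda>a b. lower (e a b)) (Dom K f) (\<lambda>a. lower (l a)) X"
    if X: "light X" for X
  proof (rule light_tame_parts[OF J lower_diagram[OF dgF] pw(1) _ _ _ _ _ X, folded \<J>_def])
    show "lower (l a) \<cdot> lower (q a j) = lower (t j)" if "a \<in> \<J>" "j \<in> a" for a j
      using lower_Comp[OF qh[OF that] lh[OF that(1)]] lqE[OF that] by simp
    show "lower (e a a') \<cdot> lower (q a j) = lower (q a' j)" if "(a, a') \<in> inclusion_order \<J>" "j \<in> a" for a a' j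
      using lower_Comp[OF qh[OF eqE(2)[OF that] that(2)] diagram_homD[OF e that(1)]] eqE(1)[OF that] by simp
  qed (rule pwJ(1) lower_diagram[OF e] lower_cocone[OF e l]; assumption?)+

  have bdJ: "bounded_by |Pow V| (inclusion_order \<J>)"
    unfolding \<J>_def by (rule bounded_by_directed_parts[OF \<mu> V(1) J(1)])
  have IF: "a \<in> \<J>" "a' \<in> \<J>" if "(a, a') \<in> inclusion_order \<J>" for a a' using that by (auto simp: inclusion_order_def)
  have eh: "lower (e a a') \<in> hom K (Dom K (g a)) (Dom K (g a'))"
    "upper (e a a') \<in> hom K (Cod K (g a)) (Cod K (g a'))"
    "upper (e a a') \<cdot> g a = g a' \<cdot> lower (e a a')"
    "lower (l a') \<cdot> lower (e a a') = lower (l a)" "upper (l a') \<cdot> upper (e a a') = upper (l a)"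
    if aa: "(a, a') \<in> inclusion_order \<J>" for a a'
    using hom_ED(5-7)[OF diagram_homD[OF e aa]] cocone_comp[OF lower_cocone[OF e l] aa]
      cocone_comp[OF upper_cocone[OF e l] aa] by auto
  have ll: "g a \<in> hom K (Dom K (g a)) (Cod K (g a))" "lower (l a) \<in> hom K (Dom K (g a)) M"
    "upper (l a) \<in> hom K (Cod K (g a)) (Cod K f)" "upper (l a) \<cdot> g a = f \<cdot> lower (l a)"
    "(g a, lower (l a), upper (l a), f) \<in> I" if "a \<in> \<J>" for a
    using hom_ED[OF lh[OF that]] Mf by auto

  \<comment> \<open>\<open>C\<close> -> \<open>Cod K f\<close> lifts to the codomain of one part and
    \<open>A\<close> -> \<open>M\<close> to the domain of another; \<open>a3\<close> lies above
    both.\<close>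
  obtain a1 h1 where a1: "a1 \<in> \<J>" "h1 \<in> hom K C (Cod K (g a1))" "upper (l a1) \<cdot> h1 = nC"
    using tame_factor[OF tame_up[OF C] nC] by auto
  have "m z \<in> hom K A (Dom K f)" using mz Mf by simp
  from tame_factor[OF tame_low[OF A] this]
  obtain a2 h2 where a2: "a2 \<in> \<J>" "h2 \<in> hom K A (Dom K (g a2))" "lower (l a2) \<cdot> h2 = m z"
    by auto
  obtain a3 where a3: "(a1, a3) \<in> inclusion_order \<J>" "(a2, a3) \<in> inclusion_order \<J>"
    using bounded_by_pair[OF Cinfinite_Pow_V bdJ, of a1 a2] a1(1) a2(1) by auto
  note a3J = IF(2)[OF a3(1)]
  define h3 where "h3 = upper (e a1 a3) \<cdot> h1"
  define k3 where "k3 = lower (e a2 a3) \<cdot> h2"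
  have h3: "h3 \<in> hom K C (Cod K (g a3))" "upper (l a3) \<cdot> h3 = nC"
    unfolding h3_def using Comp_in_hom[OF a1(2) eh(2)[OF a3(1)]]
      Comp_assoc[OF a1(2) eh(2)[OF a3(1)] ll(3)[OF a3J]] eh(5)[OF a3(1)] a1(3) by simp_all
  have k3: "k3 \<in> hom K A (Dom K (g a3))" "lower (l a3) \<cdot> k3 = m z"
    unfolding k3_def using Comp_in_hom[OF a2(2) eh(1)[OF a3(2)]]
      Comp_assoc[OF a2(2) eh(1)[OF a3(2)] ll(2)[OF a3J]] eh(4)[OF a3(2)] a2(3) by simp_all
  \<comment> \<open>The two arrows from \<open>A\<close> to the codomain of \<open>g a3\<close> are
    known to agree only in \<open>Cod K f\<close>. Tameness of \<open>A\<close> makes them agree at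
    a later part \<open>a4\<close>.\<close>
  have "upper (l a3) \<cdot> (g a3 \<cdot> k3) = upper (l a3) \<cdot> (h3 \<cdot> c)"
    using Comp_assoc[OF k3(1) ll(1)[OF a3J] ll(3)[OF a3J]] ll(4)[OF a3J]
      Comp_assoc[OF k3(1) ll(2)[OF a3J] f] k3(2) nCc h3(2) Comp_assoc[OF c h3(1) ll(3)[OF a3J]] by simp
  with tame_equalize[OF tame_up[OF A] _ Comp_in_hom[OF k3(1) ll(1)[OF a3J]] Comp_in_hom[OF c h3(1)]]
  obtain a4 where a4: "(a3, a4) \<in> inclusion_order \<J>"
    and eq4: "upper (e a3 a4) \<cdot> (g a3 \<cdot> k3) = upper (e a3 a4) \<cdot> (h3 \<cdot> c)"
    using a3J by auto
  note a4J = IF(2)[OF a4]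
  \<comment> \<open>Now \<open>A \<rightarrow> C \<rightarrow> N\<close> has been factored through a subdiagram colimit \<open>f' : X' \<rightarrow> Y'\<close> of \<open>f : M \<rightarrow> N\<close>.\<close>
  define X' where "X' = Dom K (g a4)"
  define Y' where "Y' = Cod K (g a4)"
  define f' where "f' = g a4"
  define x' where "x' = lower (l a4)"
  define y' where "y' = upper (l a4)"
  define eC where "eC = upper (e a3 a4) \<cdot> h3"
  define a where "a = lower (e a3 a4) \<cdot> k3"
  have f': "f' \<in> hom K X' Y'" and x': "x' \<in> hom K X' M" and y': "y' \<in> hom K Y' (Cod K f)"
    and sq2: "(f', x', y', f) \<in> I"
    using ll[OF a4J] by (simp_all add: f'_def x'_def y'_def X'_def Y'_def)
  have eC: "eC \<in> hom K C Y'" "y' \<cdot> eC = nC"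
    unfolding eC_def y'_def Y'_def using Comp_in_hom[OF h3(1) eh(2)[OF a4]]
      Comp_assoc[OF h3(1) eh(2)[OF a4] ll(3)[OF a4J]] eh(5)[OF a4] h3(2) by simp_all
  have a: "a \<in> hom K A X'" "x' \<cdot> a = m z"
    unfolding a_def x'_def X'_def using Comp_in_hom[OF k3(1) eh(1)[OF a4]]
      Comp_assoc[OF k3(1) eh(1)[OF a4] ll(2)[OF a4J]] eh(4)[OF a4] k3(2) by simp_all
  have f'a: "f' \<cdot> a = eC \<cdot> c"
    unfolding f'_def a_def eC_def
    using Comp_assoc[OF k3(1) eh(1)[OF a4] ll(1)[OF a4J]] eh(3)[OF a4]
      Comp_assoc[OF k3(1) ll(1)[OF a3J] eh(2)[OF a4]] eq4 Comp_assoc[OF c h3(1) eh(2)[OF a4]] by simp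

  have X'O: "X' \<in> Obj K" using hom_Obj[OF x'] by blast
  have dgL: "diagram K (Restr J a4) (\<lambda>i. Dom K (F i)) (\<lambda>i j. lower (s i j))"
    by (rule diagram_Restr[OF lower_diagram[OF dgF]])
  \<comment> \<open>\<open>X'\<close> is a colimit of at most \<open>|Pow V|\<close> domains of
    generators. These are light, hence tame for the chain, and \<open>tame_colimit\<close>
    applies.\<close>
  have "tame E |W| (\<lambda>i. Id K (D i)) (\<lambda>i j. emb (d i j)) (Id K M) (\<lambda>i. emb (m i)) (Id K X')"
  proof (rule E.tame_colimit[OF Cinfinite_Pow_V emb_diagram[OF dg] emb_cocone[OF dg mc] W(3) trW _
        emb_diagram[OF dgL] emb_colimit[OF dgL pwJ(1)[OF a4J], folded X'_def]])
    show "|Field (Restr J a4)| \<le>o |Pow V|" using JD(2,4)[OF a4J] by simp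
    fix j assume "j \<in> Field (Restr J a4)"
    then have "j \<in> Field J" by (auto simp: Field_def)
    then show "tame E |W| (\<lambda>i. Id K (D i)) (\<lambda>i j. emb (d i j)) (Id K M) (\<lambda>i. emb (m i)) (Id K (Dom K (F j)))"
      using light_W P_light FP by blast
  qed
  from tame_factor[OF tame_emb[OF dg mc X'O this] x']
  obtain i w where i: "i \<in> W" and w: "w \<in> hom K X' (D i)" "m i \<cdot> w = x'" using WF by auto
  have AO: "A \<in> Obj K" using hom_Obj[OF c] by blast
  have dzi: "d z i \<in> hom K A (D i)" using diagram_homD[OF dg z(2)[OF i]] Dz by simp
  \<comment> \<open>The lift \<open>w\<close> respects the maps from \<open>A\<close> only after
    passing to \<open>M\<close>; tameness of \<open>A\<close> corrects this at a later stage
    \<open>i'\<close>.\<close>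
  have "m i \<cdot> (w \<cdot> a) = m i \<cdot> d z i"
    using Comp_assoc[OF a(1) w(1) m[OF i]] w(2) a(2) cocone_comp[OF mc z(2)[OF i]] by simp
  with tame_equalize[OF tame_emb[OF dg mc AO light_W[OF A]] _ Comp_in_hom[OF a(1) w(1)] dzi]
  obtain i' where ii': "(i, i') \<in> |W|" and eqi: "d i i' \<cdot> (w \<cdot> a) = d i i' \<cdot> d z i"
    using i WF by auto
  have i': "i' \<in> W" using ii' WF by (auto simp: Field_def)
  \<comment> \<open>The stage must be strictly later: the chain makes \<open>D i'\<close>
    independent only from copies of \<open>B\<close> added after \<open>i'\<close>.\<close>
  obtain k where k: "k \<in> W" "i' \<noteq> k" "(i', k) \<in> |W|"
    using infinite_Card_order_limit[OF card_of_Card_order, of W i'] W(1) i' WF by auto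
  note dii' = diagram_homD[OF dg ii'] and di'k = diagram_homD[OF dg k(3)]
  define w' where "w' = d i i' \<cdot> w"
  have w': "w' \<in> hom K X' (D i')" unfolding w'_def by (rule Comp_in_hom[OF w(1) dii'])
  have w'a: "w' \<cdot> a = d z i'"
    using Comp_assoc[OF a(1) w(1) dii'] eqi diagram_comp[OF dg z(2)[OF i] ii'] by (simp add: w'_def)
  define v where "v = d i' k \<cdot> w'"
  have v: "v \<in> hom K X' (D k)" unfolding v_def by (rule Comp_in_hom[OF w' di'k])
  have mkv: "m k \<cdot> v = x'"
    unfolding v_def w'_def
    using Comp_assoc[OF w' di'k m[OF k(1)]] cocone_comp[OF mc k(3)]
      Comp_assoc[OF w(1) dii' m[OF i']] cocone_comp[OF mc ii'] w(2) by (simp add: w'_def)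

  \<comment> \<open>\<open>S1\<close> shrinks \<open>D i'\<close> to \<open>X'\<close>, and
    \<open>S2\<close> shrinks \<open>M\<close> to \<open>D k\<close> in the square from
    \<open>f'\<close> to \<open>f\<close>. Stacking along \<open>v\<close> gives \<open>S3\<close>,
    with left edge through \<open>Y'\<close>, which \<open>S4\<close> shrinks to
    \<open>C\<close>.\<close>
  have S0: "(w' \<cdot> a, ab, d i' k, b k) \<in> I" using ind[OF k(3,2)] w'a by simp
  have S1: "(a, ab, v, b k) \<in> I" unfolding v_def by (rule left_monotonic[OF S0 a(1) w' di'k])
  have S2: "(f', v, y', f \<cdot> m k) \<in> I"
    by (rule monotonic[OF _ v m[OF k(1)] f]) (simp add: mkv sq2)
  have S3: "(eC \<cdot> c, ab, y', f \<cdot> m k \<cdot> b k) \<in> I" using stack[OF S1 S2] f'a by simp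
  have S4: "(c, ab, nC, f \<cdot> m k \<cdot> b k) \<in> I" using left_monotonic[OF S3 c eC(1) y'] eC(2) by simp
  have bk: "b k \<in> hom K B (D k)" and va: "v \<cdot> a = b k \<cdot> ab"
    using indepD[OF notion S1] homD[OF v] homD[OF ab] by (simp_all add: hom_def)
  \<comment> \<open>Thus \<open>A\<close> -> \<open>M\<close> factors through \<open>B\<close>, and
    right monotonicity of \<open>I1\<close> passes from \<open>M\<close> to \<open>B\<close> in the
    square \<open>sq1\<close>.\<close>
  have "(m k \<cdot> b k) \<cdot> ab = m z"
    using Comp_assoc[OF ab bk m[OF k(1)]] va Comp_assoc[OF a(1) v m[OF k(1)]] mkv a(2) by simp
  then have "(c, (m k \<cdot> b k) \<cdot> ab, nC, f) \<in> I1" using sq1 by simp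
  moreover have mb: "m k \<cdot> b k \<in> hom K B M" by (rule Comp_in_hom[OF bk m[OF k(1)]])
  ultimately have "(c, ab, nC, f \<cdot> (m k \<cdot> b k)) \<in> I1"
    using I1(3) homD[OF ab] homD[OF mb] homD[OF f] unfolding right_monotonic_def by metis
  then show ?thesis using S4 Comp_assoc[OF bk m[OF k(1)] f] by auto
qed

end

section \<open>Equality from common squares\<close>

text \<open>By uniqueness for \<open>I1\<close> a given square of \<open>I1\<close> and the common
  one have a common extension. The latter square is in \<open>I2\<close>, so the extension is, and
  independence descends to the given square.\<close>

lemma independence_subset_of_common_squares:
  assumes I1: "independence_notion K I1" "has_uniqueness K I1" and I2: "independence_notion K I2"
    and common: "\<And>ab ac. ab \<in> Arr K \<Longrightarrow> ac \<in> Arr K \<Longrightarrow> Dom K ab = Dom K ac \<Longrightarrow>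
      \<exists>bd cd. (ab, ac, bd, cd) \<in> I1 \<and> (ab, ac, bd, cd) \<in> I2"
  shows "I1 \<subseteq> I2"
proof
  fix s assume "s \<in> I1"
  then obtain ab ac bd cd where s: "s = (ab, ac, bd, cd)" "(ab, ac, bd, cd) \<in> I1" by (cases s) auto
  note h = indepD[OF I1(1) s(2)]
  obtain bd' cd' where sq: "(ab, ac, bd', cd') \<in> I1" "(ab, ac, bd', cd') \<in> I2"
    using common[OF homD(1)[OF h(1)] homD(1)[OF h(2)]] homD(2)[OF h(2)] by auto
  note h' = indepD[OF I1(1) sq(1)]
  obtain Z e1 e2 where e: "e1 \<in> hom K (Cod K bd) Z" "e2 \<in> hom K (Cod K bd') Z"
    "e1 \<cdot>\<^bsub>K\<^esub> bd = e2 \<cdot>\<^bsub>K\<^esub> bd'" "e1 \<cdot>\<^bsub>K\<^esub> cd = e2 \<cdot>\<^bsub>K\<^esub> cd'"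
    using I1(2) s(2) sq(1) unfolding has_uniqueness_def by blast
  have "e2 \<in> hom K (Cod K cd') Z" using e(2) homD(3)[OF h'(3)] by simp
  from indep_extend[OF I2 sq(2) this] have "(ab, ac, e1 \<cdot>\<^bsub>K\<^esub> bd, e1 \<cdot>\<^bsub>K\<^esub> cd) \<in> I2" using e(3,4) by simp
  then have "(ab, ac, bd, cd) \<in> I2"
  proof (rule indep_restrict[OF I2])
    show "(ab, ac, bd, cd) \<in> comm_squares K" using I1(1) s(2) unfolding independence_notion_def by blast
    show "e1 \<in> hom K (Cod K cd) Z" using e(1) homD(3)[OF h(3)] by simp
  qed
  then show "s \<in> I2" using s(1) by simp
qed

lemma canonicity:
  fixes \<kappa> :: "'u rel" and K :: "('o, 'm) cat"
  assumes \<kappa>: "inaccessible \<kappa>" and K: "category K" and cb: "has_chain_bounds \<kappa> K"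
    and I1: "independence_notion K I1" "has_existence K I1" "has_uniqueness K I1" "right_monotonic K I1"
    and I2: "independence_notion K I2" "has_existence K I2" "has_uniqueness K I2" "transitive K I2"
      "right_accessible \<kappa> K I2"
  shows "I1 = I2"
proof -
  let ?E = "indep_cat K I2"
  have catE: "category ?E" using I2(5) by (simp add: right_accessible_def accessible_def)
  obtain \<mu> :: "'u rel" where \<mu>: "Cinfinite \<mu>" "regularCard \<mu>" "\<mu> <o \<kappa>" "accessible_at \<kappa> \<mu> ?E"
    using I2(5) unfolding right_accessible_def accessible_def by blast
  obtain P where P: "small \<kappa> P" "\<And>p. p \<in> P \<Longrightarrow> presentable \<kappa> \<mu> ?E p"
    and gen0: "\<forall>Y \<in> Obj ?E. \<exists>(r :: 'u rel) D d c.
           directed_poset \<mu> r \<and> small \<kappa> (Field r) \<and> diagram ?E r D d \<and>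
           (\<forall>i \<in> Field r. D i \<in> P) \<and> colimit ?E r D d Y c"
    using \<mu>(4) unfolding accessible_at_def by blast
  have colims: "\<exists>f t. colimit ?E r F s f t" if "directed_poset \<mu> r" "small \<kappa> (Field r)" "diagram ?E r F s"
    for r :: "'u rel" and F s using \<mu>(4) that unfolding accessible_at_def by blast
  interpret I: independence K I2
    using K I2(1-4) catE by (simp add: independence_def independence_axioms_def)
  have gen: "\<exists>(r :: 'u rel) F s t. directed_poset \<mu> r \<and> small \<kappa> (Field r) \<and> diagram ?E r F s \<and>
      (\<forall>i \<in> Field r. F i \<in> P) \<and> colimit ?E r F s f t" if "f \<in> Arr K" for f
    using gen0 that by simp
  have "\<exists>r :: 'u rel. \<exists>F s t. directed_poset \<mu> r \<and> small \<kappa> (Field r) \<and> diagram ?E r F s \<and>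
      (\<forall>i \<in> Field r. F i \<in> P) \<and> colimit ?E r F s (Id K X) t" if "X \<in> Obj K" for X
    using gen[OF homD(1)[OF I.Id_in_hom[OF that]]] .
  \<comment> \<open>An index poset of a presentation by generators is fixed for each object in
    advance, so that \<open>V\<close> can be chosen to absorb those that matter.\<close>
  then obtain R :: "'o \<Rightarrow> 'u rel" where R: "\<And>X. X \<in> Obj K \<Longrightarrow> \<exists>F s t. directed_poset \<mu> (R X) \<and>
      small \<kappa> (Field (R X)) \<and> diagram ?E (R X) F s \<and> (\<forall>i \<in> Field (R X). F i \<in> P) \<and> colimit ?E (R X) F s (Id K X) t"
    by metis
  have C\<kappa>: "Cinfinite \<kappa>" by (rule inaccessible_Cinfinite[OF \<kappa>])
  have st: "stable \<kappa>"
    using regularCard_stable[of \<kappa>] C\<kappa> \<kappa> unfolding inaccessible_def cinfinite_def by blast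
  have PO: "Dom K p \<in> Obj K" if "p \<in> P" for p
    using P(2)[OF that] I.Dom_in_Obj by (simp add: presentable_def)
  have common: "\<exists>bd cd. (c, ab, bd, cd) \<in> I1 \<and> (c, ab, bd, cd) \<in> I2"
    if span: "c \<in> Arr K" "ab \<in> Arr K" "Dom K c = Dom K ab" for c ab
  proof -
    define A where "A = Dom K c"
    define C where "C = Cod K c"
    have c: "c \<in> hom K A C" using homI[OF span(1)] by (simp add: A_def C_def)
    have ab: "ab \<in> hom K A (Cod K ab)" using homI[OF span(2)] span(3) by (simp add: A_def)
    \<comment> \<open>The objects that have to be light for this span; as \<open>P\<close> is small,
      there are few of them.\<close>
    define X where "X = {A, C} \<union> Dom K ` P"
    have XO: "X \<subseteq> Obj K" using I.hom_Obj[OF c] PO by (auto simp: X_def)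
    \<comment> \<open>Large enough to contain \<open>\<mu>\<close> and the index sets of all objects
      in \<open>X\<close>, yet small by regularity of \<open>\<kappa>\<close>.\<close>
    define V where "V = Field \<mu> \<union> (\<Union>x \<in> X. Field (R x))"
    have "|Dom K ` P| <o \<kappa>" using P(1) card_of_image ordLeq_ordLess_trans unfolding small_def by blast
    then have "|X| <o \<kappa>"
      unfolding X_def using small_finite[OF \<kappa>, of "{A, C}", unfolded small_def]
      by (intro Un_Cinfinite_bound_strict[OF _ _ C\<kappa>]) simp_all
    then have "|\<Union>x \<in> X. Field (R x)| <o \<kappa>"
      using R XO by (intro stable_UNION[OF st]) (auto simp: small_def)
    moreover have "|Field \<mu>| <o \<kappa>"
      using ordIso_ordLess_trans[OF card_of_Field_ordIso \<mu>(3)] \<mu>(1) by blast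
    ultimately have Vs: "small \<kappa> V" unfolding small_def V_def using Un_Cinfinite_bound_strict C\<kappa> by blast
    have \<mu>V: "\<mu> \<le>o |V|"
      using ordIso_ordLeq_trans[OF ordIso_symmetric[OF card_of_Field_ordIso] card_of_mono1[of "Field \<mu>" V]] \<mu>(1)
      by (auto simp: V_def)
    interpret G: generated_independence K I2 \<kappa> \<mu> V P
      using \<kappa> \<mu>(1,2) \<mu>V Vs colims P(2) gen by unfold_locales blast+
    have light: "G.light x" if x: "x \<in> X" for x
    proof -
      have "|Field (R x)| \<le>o |V|" using x by (intro card_of_mono1) (auto simp: V_def)
      then have "|Field (R x)| \<le>o |Pow V|" using ordLeq_transitive ordLess_imp_ordLeq[OF card_of_Pow] by blast
      moreover have xO: "x \<in> Obj K" using x XO by blast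
      ultimately show ?thesis unfolding G.light_def using R[OF xO] by blast
    qed
    show ?thesis
      by (rule G.common_square[OF cb I1(1,2,4) c ab]) (auto intro!: light simp: X_def)
  qed
  show ?thesis
  proof
    show "I1 \<subseteq> I2" by (rule independence_subset_of_common_squares[OF I1(1,3) I2(1)]) (rule common)
    show "I2 \<subseteq> I1" by (rule independence_subset_of_common_squares[OF I2(1,3) I1(1)]) (use common in blast)
  qed
qed

theorem theoremA6:
  fixes \<kappa> :: "'u rel" and K :: "('o, 'm) cat"
  assumes "inaccessible \<kappa>"
    and "category K"
    and "has_chain_bounds \<kappa> K"
  shows "(\<forall>I1 I2.
            independence_notion K I1 \<and> has_existence K I1 \<and> has_uniqueness K I1 \<and>
            independence_notion K I2 \<and> has_existence K I2 \<and> has_uniqueness K I2 \<and>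
            right_monotonic K I1 \<and>
            transitive K I2 \<and> right_accessible \<kappa> K I2 \<longrightarrow> I1 = I2) \<and>
         (\<exists>\<^sub>\<le>\<^sub>1 I. stable_notion \<kappa> K I)"
proof
  show "\<forall>I1 I2.
            independence_notion K I1 \<and> has_existence K I1 \<and> has_uniqueness K I1 \<and>
            independence_notion K I2 \<and> has_existence K I2 \<and> has_uniqueness K I2 \<and>
            right_monotonic K I1 \<and>
            transitive K I2 \<and> right_accessible \<kappa> K I2 \<longrightarrow> I1 = I2"
    using canonicity[OF assms] by blast
  show "\<exists>\<^sub>\<le>\<^sub>1 I. stable_notion \<kappa> K I"
  proof (rule Uniq_I)
    fix I1 I2 assume I1: "stable_notion \<kappa> K I1" and I2: "stable_notion \<kappa> K I2"
    \<comment> \<open>Stability provides transitivity, existence and uniqueness, from which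
      monotonicity follows; thus a stable notion can stand on either side of
      \<open>canonicity\<close>.\<close>
    have "right_monotonic K I1"
      using category.right_monotonicI[OF assms(2)] I1 unfolding stable_notion_def transitive_def by blast
    then show "I1 = I2"
      using canonicity[OF assms] I1 I2 unfolding stable_notion_def accessible_notion_def by blast
  qed
qed

end
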